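(* Assume that the boundary conditions hold, that $0<\epsilon\le c_h^n\le\frac{\varrho}{\beta}<\frac1\beta$, and that the stabilization parameter $\theta_n$ is taken as $$\theta_n=\max_{K\in\mathcal{K}_h}\left\{1,\ \frac{(1-\beta c_h^n)^2}{\chi_1^n(1-\chi_1^n\beta c_h^n)^2},\ \frac{(1-\beta c_h^n)^2}{\chi_2^n(1-\chi_2^n\beta c_h^n)^2}\right\},$$ where $\chi_1^n=1-\delta_1(1-\beta c_h^n)^2$, $\chi_2^n=1+\delta_2(1-\beta c_h^n)^2$ with $0<\delta_1,\delta_2<1$. Let $(\boldsymbol u_{s,h}^{n+1},\boldsymbol u_{f,h}^{n+1},c_h^{n+1},\phi_h^{n+1},p_h^{n+1})$ be a solution of the fully discrete scheme (i)–(v) in the context, with $\chi_1^nc_h^n\le c_h^{n+1}\le\chi_2^nc_h^n$. Then the total free energy is dissipated: $$D_\tau E_h^{n+1}=\frac{E_h^{n+1}-E_h^n}{\tau}\le0,$$ where $$E_h^{n+1}=\sum_{K\in\mathcal{K}_h}\int_K\left(\phi_h^{n+1}f(c_h^{n+1})+\frac12\boldsymbol\sigma_e(\boldsymbol u_{s,h}^{n+1}):\boldsymbol\varepsilon(\boldsymbol u_{s,h}^{n+1})+\frac1{2N}|p_h^{n+1}|^2\right)d\boldsymbol x+\sum_{e\in\mathcal{E}_h^I}\frac{\varsigma_2}{2h_e}\langle[\boldsymbol u_{s,h}^{n+1}],[\boldsymbol u_{s,h}^{n+1}]\rangle_e-\sum_{e\in\mathcal{E}_h^I}\langle\{\boldsymbol\sigma_e(\boldsymbol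 u_{s,h}^{n+1})\boldsymbol n_e\},[\boldsymbol u_{s,h}^{n+1}]\rangle_e$$ and $E_h^n$ is the same expression with time index $n$ in place of $n+1$.
   Context: Mesh and spaces: $\mathcal{K}_h$ is a non-degenerate quasi-uniform simplicial mesh of $\Omega\subset\mathbb{R}^d$, $d\in\{2,3\}$; $\mathcal{E}_h^I$ is the set of interior edges/faces; $h_e$ is the length (2D) or area (3D) of $e$. For $e=\partial K_i\cap\partial K_j$ with unit normal $\boldsymbol n_e$ from $K_i$ to $K_j$: $[\psi]=\psi|_{K_i}-\psi|_{K_j}$, $\{\psi\}=\frac12(\psi|_{K_i}+\psi|_{K_j})$; $\boldsymbol n=\boldsymbol n_e$ in face sums. $\mathcal{V}_h$: discontinuous piecewise linear $d$-vector fields; $\mathcal{Q}_h$: piecewise constants; $\mathcal{U}_h$: lowest-order Raviart–Thomas space in $H(\mathrm{div},\Omega)$; $\mathcal{U}_h^0=\{\mathbf v\in\mathcal{U}_h:\mathbf v\cdot\boldsymbol n=0\text{ on }\partial\Omega\}$. $(\cdot,\cdot)_K$, $\langle\cdot,\cdot\rangle_e$ are $L^2$ inner products and $(\cdot,\cdot)=\sum_K(\cdot,\cdot)_K$ (derivatives elementwise). $D_\tau X^{n+1}=(X^{n+1}-X^n)/\tau$ with time step $\tau>0$. Physics: $R,T,b,\beta>0$ constants; $f(c)=cRT\ln c-cRT\ln(1-\beta c)+\frac{bc}{2\sqrt2\beta}\ln\frac{1+(1-\sqrt2)\beta c}{1+(1+\sqrt2)\beta c}$, $\mu(c)=f'(c)$.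 $\alpha$ is Biot's coefficient, $N>0$ Biot's modulus (a constant), $\eta,\gamma>0$ Lamé parameters, $\boldsymbol\varepsilon(\boldsymbol u)=\frac12(\nabla\boldsymbol u+\nabla\boldsymbol u^T)$, $\boldsymbol\sigma_e(\boldsymbol u)=2\eta\boldsymbol\varepsilon(\boldsymbol u)+\gamma(\nabla\cdot\boldsymbol u)\boldsymbol I$. Mobility $\lambda(\phi)=\kappa(\phi)/\nu$, viscosity $\nu>0$, $\kappa(\phi)=\kappa^0(\phi/\phi_r)^3\left(\frac{1-\phi_r}{1-\phi}\right)^2$, where $\kappa^0>0$ is the initial intrinsic permeability and $\phi_r$ the reference porosity; porosities take values in $(0,1)$. Boundary conditions: zero traction $\boldsymbol\sigma\cdot\boldsymbol n=0$ and $\boldsymbol u_f\cdot\boldsymbol n=0$ on $\partial\Omega$ (so $\boldsymbol u_{f,h}\cdot\boldsymbol n=0$ on $\partial\Omega$). $\varsigma_1,\varsigma_2>0$ are penalty parameters. Bilinear form: $$\mathcal{A}(\boldsymbol u,p,\mathbf v)=\sum_K(\boldsymbol\sigma_e(\boldsymbol u),\boldsymbol\varepsilon(\mathbf v))_K-\sum_{e\in\mathcal{E}_h^I}\langle\{\boldsymbol\sigma_e(\boldsymbol u)\boldsymbol n_e\},[\mathbf v]\rangle_e-\alpha\sum_K(p,\nabla\cdot\mathbf v)_K+\alpha\sum_{e\in\mathcal{E}_h^I}\langle\{p\boldsymbol n_e\},[\mathbf v]\rangle_e-\sum_{e\in\mathcal{E}_h^I}\langle[\boldsymbol u],\{\boldsymbol\sigma_e(\mathbf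 v)\boldsymbol n_e\}\rangle_e+\sum_{e\in\mathcal{E}_h^I}\frac{\varsigma_2}{h_e}\langle[\boldsymbol u],[\mathbf v]\rangle_e .$$ Upwinding: $c_h^{n*}=c_h^n|_{K_i}$ if $\boldsymbol u_{f,h}^n\cdot\boldsymbol n_e\ge0$, else $c_h^n|_{K_j}$. Stabilized chemical potential: $\mu_h^{n+1}=\mu(c_h^n)+\theta_nRT\frac{c_h^{n+1}-c_h^n}{c_h^n(1-\beta c_h^n)^2}$. Fully discrete scheme: given time-level-$n$ quantities, find $\boldsymbol u_{s,h}^{n+1}\in\mathcal{V}_h$, $\boldsymbol u_{f,h}^{n+1}\in\mathcal{U}_h$ (zero normal component on $\partial\Omega$), $c_h^{n+1},\phi_h^{n+1},p_h^{n+1}\in\mathcal{Q}_h$ such that for all $\mathbf v_h\in\mathcal{V}_h$, $\mathbf w_h\in\mathcal{U}_h^0$, $q_h,z_h,\varphi_h\in\mathcal{Q}_h$: (i) $\mathcal{A}(\boldsymbol u_{s,h}^{n+1},p_h^{n+1},\mathbf v_h)=0$; (ii) $(D_\tau(\phi_h^{n+1}c_h^{n+1}),q_h)+\sum_{e\in\mathcal{E}_h^I}\langle c_h^{n*}\boldsymbol u_{f,h}^{n+1}\cdot\boldsymbol n,[q_h]\rangle_e+\sum_{e\in\mathcal{E}_h^I}\frac{\varsigma_1}{h_e}\langle[\mu_h^{n+1}],[q_h]\rangle_e=0$; (iii) $(\lambda^{-1}(\phi_h^n)\boldsymbol u_{f,h}^{n+1},\mathbf w_h)=\sum_{e\in\mathcal{E}_h^I}\langle[\mu_h^{n+1}],c_h^{n*}\mathbf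 w_h\cdot\boldsymbol n\rangle_e$; (iv) $(p_h^{n+1},z_h)=(c_h^n\mu_h^{n+1}-f(c_h^n),z_h)$; (v) $(D_\tau\phi_h^{n+1},\varphi_h)=\frac1N(D_\tau p_h^{n+1},\varphi_h)+\alpha(D_\tau(\nabla\cdot\boldsymbol u_{s,h}^{n+1}),\varphi_h)-\alpha\sum_{e\in\mathcal{E}_h^I}\langle\{\varphi_h\boldsymbol n_e\},[D_\tau\boldsymbol u_{s,h}^{n+1}]\rangle_e$.
   Formalization: The penalty parameter ς₂ is required to be at least some threshold ς₀>0 depending only on Ω, d, the Lamé parameters and the mesh-regularity constants; for arbitrarily small ς₂>0 the interior penalty form is indefinite and the claim fails. *)

theory Defs
  imports "HOL-Analysis.Analysis"
begin

section \<open>Meshes\<close>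

text \<open>For an interior face \<open>e\<close> of the mesh, \<open>cell_i M e\<close> and \<open>cell_j M e\<close> are the two
  elements \<open>K\<^sub>i\<close>, \<open>K\<^sub>j\<close> sharing \<open>e\<close>, and \<open>unit_normal M e\<close> is \<open>n\<^sub>e\<close>, pointing from \<open>K\<^sub>i\<close> to \<open>K\<^sub>j\<close>.
  Which of the two elements is \<open>K\<^sub>i\<close> is an arbitrary choice, made by the mesh.\<close>

record 'd mesh =
  region :: "(real ^ 'd) set"
  cells  :: "(real ^ 'd) set set"
  cell_i :: "(real ^ 'd) set \<Rightarrow> (real ^ 'd) set"
  cell_j :: "(real ^ 'd) set \<Rightarrow> (real ^ 'd) set"
  unit_normal :: "(real ^ 'd) set \<Rightarrow> real ^ 'd"

definition interior_faces :: "'d::finite mesh \<Rightarrow> (real ^ 'd) set set" where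
  "interior_faces M = {e. \<exists>K\<in>cells M. \<exists>K'\<in>cells M.
      K \<noteq> K' \<and> e = K \<inter> K' \<and> e facet_of K \<and> e facet_of K' \<and> \<not> e \<subseteq> frontier (region M)}"

definition simplicial_mesh :: "'d::finite mesh \<Rightarrow> bool" where
  "simplicial_mesh M \<longleftrightarrow>
     open (region M) \<and> bounded (region M) \<and> region M \<noteq> {} \<and>
     triangulation (cells M) \<and>
     (\<forall>K\<in>cells M. int CARD('d) simplex K) \<and>
     \<Union> (cells M) = closure (region M) \<and>
     (\<forall>e\<in>interior_faces M.
        cell_i M e \<in> cells M \<and> cell_j M e \<in> cells M \<and> cell_i M e \<noteq> cell_j M e \<and>
        e = cell_i M e \<inter> cell_j M e \<and>
        norm (unit_normal M e) = 1 \<and>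
        (\<forall>x\<in>cell_i M e. \<forall>y\<in>e. \<forall>z\<in>cell_j M e.
           unit_normal M e \<bullet> x \<le> unit_normal M e \<bullet> y \<and> unit_normal M e \<bullet> y \<le> unit_normal M e \<bullet> z))"

text \<open>Non-degeneracy and quasi-uniformity are properties of mesh families; \<open>\<rho>\<close> is the constant
  common to the family.\<close>

definition nondegenerate :: "real \<Rightarrow> 'd::finite mesh \<Rightarrow> bool" where
  "nondegenerate \<rho> M \<longleftrightarrow>
     (\<forall>K\<in>cells M. \<exists>x r. cball x r \<subseteq> K \<and> \<rho> * diameter K \<le> 2 * r)"

definition quasi_uniform :: "real \<Rightarrow> 'd::finite mesh \<Rightarrow> bool" where
  "quasi_uniform \<rho> M \<longleftrightarrow>
     (\<forall>K\<in>cells M. \<forall>K'\<in>cells M. \<rho> * diameter K' \<le> diameter K)"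

section \<open>Integrals over elements and faces\<close>

definition cell_integral :: "(real ^ 'd::finite) set \<Rightarrow> (real ^ 'd \<Rightarrow> real) \<Rightarrow> real" where
  "cell_integral K g = (LINT x:K|lborel. g x)"

text \<open>The \<open>(d - 1)\<close>-dimensional Lebesgue measure on the hyperplane \<open>n \<bullet> x = s\<close> with unit
  normal \<open>n\<close>: the Lebesgue measure of the slab of thickness 1 above the hyperplane, pushed
  forward by orthogonal projection. So the size of a subset of the hyperplane is the volume of the
  right prism of height 1 over it.\<close>

definition hyperplane_measure :: "real ^ 'd::finite \<Rightarrow> real \<Rightarrow> (real ^ 'd) measure" where
  "hyperplane_measure n s =
     distr (restrict_space lborel {x. s \<le> n \<bullet> x \<and> n \<bullet> x \<le> s + 1}) borel
           (\<lambda>x. x - (n \<bullet> x - s) *\<^sub>R n)"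

definition face_measure :: "'d::finite mesh \<Rightarrow> (real ^ 'd) set \<Rightarrow> (real ^ 'd) measure" where
  "face_measure M e = hyperplane_measure (unit_normal M e) (unit_normal M e \<bullet> (SOME x. x \<in> e))"

definition face_integral ::
    "'d::finite mesh \<Rightarrow> (real ^ 'd) set \<Rightarrow> (real ^ 'd \<Rightarrow> real) \<Rightarrow> real" where
  "face_integral M e g = (LINT x:e|face_measure M e. g x)"

text \<open>\<open>h\<^sub>e\<close>: the length (2D) or area (3D) of \<open>e\<close>.\<close>

definition face_size :: "'d::finite mesh \<Rightarrow> (real ^ 'd) set \<Rightarrow> real" where
  "face_size M e = measure (face_measure M e) e"

section \<open>Broken functions and discrete spaces\<close>

text \<open>A discontinuous piecewise polynomial is a function \<open>v\<close> of an element and a point: \<open>v K\<close> is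
  the polynomial whose restriction to \<open>K\<close> is \<open>v|\<^sub>K\<close>. In particular \<open>v K x\<close> for \<open>x\<close> on a face of
  \<open>K\<close> is the trace from \<open>K\<close>. Piecewise constants (the space \<open>Q\<^sub>h\<close>) are given by their value on
  each element.\<close>

type_synonym 'd pw_const = "(real ^ 'd) set \<Rightarrow> real"
type_synonym 'd pw_field = "(real ^ 'd) set \<Rightarrow> real ^ 'd \<Rightarrow> real ^ 'd"

definition jump ::
    "'d::finite mesh \<Rightarrow> (real ^ 'd) set \<Rightarrow> ((real ^ 'd) set \<Rightarrow> 'b::real_vector) \<Rightarrow> 'b" where
  "jump M e w = w (cell_i M e) - w (cell_j M e)"

definition avg ::
    "'d::finite mesh \<Rightarrow> (real ^ 'd) set \<Rightarrow> ((real ^ 'd) set \<Rightarrow> 'b::real_vector) \<Rightarrow> 'b" where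
  "avg M e w = (1 / 2) *\<^sub>R (w (cell_i M e) + w (cell_j M e))"

definition Vh :: "'d::finite mesh \<Rightarrow> 'd pw_field set" where
  "Vh M = {v. \<forall>K\<in>cells M. \<exists>A a. v K = (\<lambda>x. A *v x + a)}"

definition partial :: "'d::finite \<Rightarrow> (real ^ 'd \<Rightarrow> real) \<Rightarrow> real ^ 'd \<Rightarrow> real" where
  "partial i g = (\<lambda>x. frechet_derivative g (at x) (axis i 1))"

definition smooth :: "(real ^ 'd::finite \<Rightarrow> real) \<Rightarrow> bool" where
  "smooth g \<longleftrightarrow> (\<forall>is. foldr partial is g differentiable_on UNIV)"

definition test_functions :: "(real ^ 'd::finite) set \<Rightarrow> (real ^ 'd \<Rightarrow> real) set" where
  "test_functions \<Omega> = {g. smooth g \<and> compact (closure {x. g x \<noteq> 0}) \<and> closure {x. g x \<noteq> 0} \<subseteq> \<Omega>}"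

text \<open>A piecewise polynomial field is in \<open>H(div, \<Omega>)\<close> if its distributional divergence is a
  function in \<open>L\<^sup>2(\<Omega>)\<close>, here called \<open>g\<close>.\<close>

definition Hdiv :: "'d::finite mesh \<Rightarrow> 'd pw_field \<Rightarrow> bool" where
  "Hdiv M w \<longleftrightarrow>
     (\<exists>g \<in> borel_measurable lborel.
        set_integrable lborel (region M) (\<lambda>x. (g x :: real)\<^sup>2) \<and>
        (\<forall>\<psi>\<in>test_functions (region M).
           (\<Sum>K\<in>cells M. cell_integral K (\<lambda>x. w K x \<bullet> (\<chi> i. partial i \<psi> x))) =
           - (LINT x:region M|lborel. g x * \<psi> x)))"

definition Uh :: "'d::finite mesh \<Rightarrow> 'd pw_field set" where
  "Uh M = {w. (\<forall>K\<in>cells M. \<exists>a b. w K = (\<lambda>x. a + b *\<^sub>R x)) \<and> Hdiv M w}"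

definition Uh0 :: "'d::finite mesh \<Rightarrow> 'd pw_field set" where
  "Uh0 M = {w \<in> Uh M. \<forall>K\<in>cells M. \<forall>e. e facet_of K \<and> e \<subseteq> frontier (region M) \<longrightarrow>
      (\<forall>m. (\<forall>x\<in>e. \<forall>y\<in>e. m \<bullet> (x - y) = 0) \<longrightarrow> (\<forall>x\<in>e. w K x \<bullet> m = 0))}"

section \<open>Physics\<close>

record params =
  gasR   :: real  \<comment> \<open>\<open>R\<close>\<close>
  temp   :: real  \<comment> \<open>\<open>T\<close>\<close>
  attr   :: real  \<comment> \<open>\<open>b\<close>\<close>
  covol  :: real  \<comment> \<open>\<open>\<beta>\<close>\<close>
  biot_alpha :: real  \<comment> \<open>Biot's coefficient \<open>\<alpha>\<close>\<close>
  biot_N :: real  \<comment> \<open>Biot's modulus \<open>N\<close>\<close>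
  lame_eta   :: real
  lame_gamma :: real
  perm0  :: real  \<comment> \<open>initial intrinsic permeability \<open>\<kappa>\<^sup>0\<close>\<close>
  por_ref :: real \<comment> \<open>reference porosity \<open>\<phi>\<^sub>r\<close>\<close>
  visc   :: real  \<comment> \<open>viscosity \<open>\<nu>\<close>\<close>
  pen1   :: real  \<comment> \<open>penalty parameters\<close>
  pen2   :: real

text \<open>Positivity of \<open>pen2\<close> alone does not make the symmetric interior penalty form nonnegative, and
  without that the discrete energy need not decay. As usual for such methods, \<open>pen2\<close> has to exceed a
  threshold depending only on the domain, the Lame constants and the shape regularity of the mesh.\<close>

definition admissible_params :: "params \<Rightarrow> bool" where
  "admissible_params P \<longleftrightarrow>
     gasR P > 0 \<and> temp P > 0 \<and> attr P > 0 \<and> covol P > 0 \<and> biot_N P > 0 \<and>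
     lame_eta P > 0 \<and> lame_gamma P > 0 \<and>
     perm0 P > 0 \<and> 0 < por_ref P \<and> por_ref P < 1 \<and> visc P > 0 \<and> pen1 P > 0 \<and> pen2 P > 0"

definition free_energy :: "params \<Rightarrow> real \<Rightarrow> real" where
  "free_energy P c =
     c * gasR P * temp P * ln c - c * gasR P * temp P * ln (1 - covol P * c)
     + attr P * c / (2 * sqrt 2 * covol P)
       * ln ((1 + (1 - sqrt 2) * covol P * c) / (1 + (1 + sqrt 2) * covol P * c))"

definition chem_pot :: "params \<Rightarrow> real \<Rightarrow> real" where
  "chem_pot P c = deriv (free_energy P) c"

definition permeability :: "params \<Rightarrow> real \<Rightarrow> real" where
  "permeability P \<phi> = perm0 P * (\<phi> / por_ref P) ^ 3 * ((1 - por_ref P) / (1 - \<phi>))\<^sup>2"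

definition mobility :: "params \<Rightarrow> real \<Rightarrow> real" where
  "mobility P \<phi> = permeability P \<phi> / visc P"

definition strain :: "(real ^ 'd \<Rightarrow> real ^ 'd) \<Rightarrow> real ^ 'd \<Rightarrow> real ^ 'd::finite ^ 'd" where
  "strain u x = (1 / 2) *\<^sub>R (jacobian u (at x) + transpose (jacobian u (at x)))"

definition divg :: "(real ^ 'd \<Rightarrow> real ^ 'd) \<Rightarrow> real ^ 'd::finite \<Rightarrow> real" where
  "divg u x = trace (jacobian u (at x))"

definition stress :: "params \<Rightarrow> (real ^ 'd \<Rightarrow> real ^ 'd) \<Rightarrow> real ^ 'd \<Rightarrow> real ^ 'd::finite ^ 'd" where
  "stress P u x = (2 * lame_eta P) *\<^sub>R strain u x + (lame_gamma P * divg u x) *\<^sub>R mat 1"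

section \<open>The fully discrete scheme\<close>

text \<open>The inner product \<open>\<bullet>\<close> of two matrices is the double contraction \<open>A : B\<close>.\<close>

definition form_A ::
    "params \<Rightarrow> 'd::finite mesh \<Rightarrow> 'd pw_field \<Rightarrow> 'd pw_const \<Rightarrow> 'd pw_field \<Rightarrow> real" where
  "form_A P M u p v =
     (\<Sum>K\<in>cells M. cell_integral K (\<lambda>x. stress P (u K) x \<bullet> strain (v K) x))
     - (\<Sum>e\<in>interior_faces M. face_integral M e (\<lambda>x.
          avg M e (\<lambda>K. stress P (u K) x *v unit_normal M e) \<bullet> jump M e (\<lambda>K. v K x)))
     - biot_alpha P * (\<Sum>K\<in>cells M. cell_integral K (\<lambda>x. p K * divg (v K) x))
     + biot_alpha P * (\<Sum>e\<in>interior_faces M. face_integral M e (\<lambda>x.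
          avg M e (\<lambda>K. p K *\<^sub>R unit_normal M e) \<bullet> jump M e (\<lambda>K. v K x)))
     - (\<Sum>e\<in>interior_faces M. face_integral M e (\<lambda>x.
          jump M e (\<lambda>K. u K x) \<bullet> avg M e (\<lambda>K. stress P (v K) x *v unit_normal M e)))
     + (\<Sum>e\<in>interior_faces M. pen2 P / face_size M e * face_integral M e (\<lambda>x.
          jump M e (\<lambda>K. u K x) \<bullet> jump M e (\<lambda>K. v K x)))"

record 'd state =
  us  :: "'d pw_field"
  uf  :: "'d pw_field"
  conc :: "'d pw_const"
  por :: "'d pw_const"
  pres :: "'d pw_const"

definition Dt :: "real \<Rightarrow> 'b::real_vector \<Rightarrow> 'b \<Rightarrow> 'b" where
  "Dt \<tau> X1 X0 = (1 / \<tau>) *\<^sub>R (X1 - X0)"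

text \<open>Fields in \<open>Uh\<close> have a single-valued normal component across interior faces, so their flux
  through \<open>e\<close> may be taken as the trace from \<open>K\<^sub>i\<close>.\<close>

definition flux :: "'d::finite mesh \<Rightarrow> (real ^ 'd) set \<Rightarrow> 'd pw_field \<Rightarrow> real ^ 'd \<Rightarrow> real" where
  "flux M e w x = w (cell_i M e) x \<bullet> unit_normal M e"

definition upwind_c :: "'d::finite mesh \<Rightarrow> 'd state \<Rightarrow> (real ^ 'd) set \<Rightarrow> real ^ 'd \<Rightarrow> real" where
  "upwind_c M S0 e x = (if flux M e (uf S0) x \<ge> 0 then conc S0 (cell_i M e) else conc S0 (cell_j M e))"

definition stab_mu :: "params \<Rightarrow> real \<Rightarrow> 'd::finite state \<Rightarrow> 'd state \<Rightarrow> 'd pw_const" where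
  "stab_mu P \<theta> S0 S1 K =
     chem_pot P (conc S0 K)
     + \<theta> * gasR P * temp P * (conc S1 K - conc S0 K) / (conc S0 K * (1 - covol P * conc S0 K)\<^sup>2)"

definition discrete_scheme ::
    "params \<Rightarrow> 'd::finite mesh \<Rightarrow> real \<Rightarrow> real \<Rightarrow> 'd state \<Rightarrow> 'd state \<Rightarrow> bool" where
  "discrete_scheme P M \<tau> \<theta> S0 S1 \<longleftrightarrow>
     us S1 \<in> Vh M \<and> uf S1 \<in> Uh0 M \<and>
     (\<forall>v\<in>Vh M. form_A P M (us S1) (pres S1) v = 0) \<and>
     (\<forall>q.
        (\<Sum>K\<in>cells M. cell_integral K (\<lambda>x. Dt \<tau> (por S1 K * conc S1 K) (por S0 K * conc S0 K) * q K))
        + (\<Sum>e\<in>interior_faces M. face_integral M e (\<lambda>x.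
             upwind_c M S0 e x * flux M e (uf S1) x * jump M e q))
        + (\<Sum>e\<in>interior_faces M. pen1 P / face_size M e * face_integral M e (\<lambda>x.
             jump M e (stab_mu P \<theta> S0 S1) * jump M e q)) = 0) \<and>
     (\<forall>w\<in>Uh0 M.
        (\<Sum>K\<in>cells M. cell_integral K (\<lambda>x. (inverse (mobility P (por S0 K)) *\<^sub>R uf S1 K x) \<bullet> w K x))
        = (\<Sum>e\<in>interior_faces M. face_integral M e (\<lambda>x.
             jump M e (stab_mu P \<theta> S0 S1) * (upwind_c M S0 e x * flux M e w x)))) \<and>
     (\<forall>z.
        (\<Sum>K\<in>cells M. cell_integral K (\<lambda>x. pres S1 K * z K))
        = (\<Sum>K\<in>cells M. cell_integral K (\<lambda>x.
             (conc S0 K * stab_mu P \<theta> S0 S1 K - free_energy P (conc S0 K)) * z K))) \<and>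
     (\<forall>\<psi>.
        (\<Sum>K\<in>cells M. cell_integral K (\<lambda>x. Dt \<tau> (por S1 K) (por S0 K) * \<psi> K))
        = 1 / biot_N P * (\<Sum>K\<in>cells M. cell_integral K (\<lambda>x. Dt \<tau> (pres S1 K) (pres S0 K) * \<psi> K))
          + biot_alpha P * (\<Sum>K\<in>cells M. cell_integral K (\<lambda>x.
              Dt \<tau> (divg (us S1 K) x) (divg (us S0 K) x) * \<psi> K))
          - biot_alpha P * (\<Sum>e\<in>interior_faces M. face_integral M e (\<lambda>x.
              avg M e (\<lambda>K. \<psi> K *\<^sub>R unit_normal M e)
              \<bullet> jump M e (\<lambda>K. Dt \<tau> (us S1 K x) (us S0 K x)))))"

definition chi1 :: "params \<Rightarrow> real \<Rightarrow> 'd::finite state \<Rightarrow> 'd pw_const" where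
  "chi1 P \<delta>\<^sub>1 S0 K = 1 - \<delta>\<^sub>1 * (1 - covol P * conc S0 K)\<^sup>2"

definition chi2 :: "params \<Rightarrow> real \<Rightarrow> 'd::finite state \<Rightarrow> 'd pw_const" where
  "chi2 P \<delta>\<^sub>2 S0 K = 1 + \<delta>\<^sub>2 * (1 - covol P * conc S0 K)\<^sup>2"

definition stab_theta ::
    "params \<Rightarrow> 'd::finite mesh \<Rightarrow> real \<Rightarrow> real \<Rightarrow> 'd state \<Rightarrow> real" where
  "stab_theta P M \<delta>\<^sub>1 \<delta>\<^sub>2 S0 = Max (\<Union>K\<in>cells M.
     {1,
      (1 - covol P * conc S0 K)\<^sup>2 / (chi1 P \<delta>\<^sub>1 S0 K * (1 - chi1 P \<delta>\<^sub>1 S0 K * covol P * conc S0 K)\<^sup>2),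
      (1 - covol P * conc S0 K)\<^sup>2 / (chi2 P \<delta>\<^sub>2 S0 K * (1 - chi2 P \<delta>\<^sub>2 S0 K * covol P * conc S0 K)\<^sup>2)})"

definition total_energy :: "params \<Rightarrow> 'd::finite mesh \<Rightarrow> 'd state \<Rightarrow> real" where
  "total_energy P M S =
     (\<Sum>K\<in>cells M. cell_integral K (\<lambda>x.
        por S K * free_energy P (conc S K)
        + 1 / 2 * (stress P (us S K) x \<bullet> strain (us S K) x)
        + 1 / (2 * biot_N P) * \<bar>pres S K\<bar>\<^sup>2))
     + (\<Sum>e\<in>interior_faces M. pen2 P / (2 * face_size M e) * face_integral M e (\<lambda>x.
          jump M e (\<lambda>K. us S K x) \<bullet> jump M e (\<lambda>K. us S K x)))
     - (\<Sum>e\<in>interior_faces M. face_integral M e (\<lambda>x.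
          avg M e (\<lambda>K. stress P (us S K) x *v unit_normal M e) \<bullet> jump M e (\<lambda>K. us S K x)))"

end

theory Submission
  imports Defs
begin

text \<open>The equation of state enters only through \<open>f''(c) \<le> RT / (c (1 - \<beta>c)\<^sup>2)\<close>. Since \<open>c (1 - \<beta>c)\<^sup>2\<close> is
  quasiconcave, its minimum between \<open>\<chi>\<^sub>1c\<^sup>n\<close> and \<open>\<chi>\<^sub>2c\<^sup>n\<close> is attained at an end point, and the choice of
  \<open>\<theta>\<^sub>n\<close> gives \<open>f(c\<^sup>n\<^sup>+\<^sup>1) - f(c\<^sup>n) \<le> \<mu>\<^sup>n\<^sup>+\<^sup>1 (c\<^sup>n\<^sup>+\<^sup>1 - c\<^sup>n)\<close> on each element. Let \<open>B\<close> be the symmetric interior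
  penalty form, so that the elastic part of the energy is \<open>B(u, u) / 2\<close>, and let \<open>w\<close> be the increment
  of the displacement. Testing the five equations of the scheme with \<open>w\<close>, \<open>\<mu>\<^sup>n\<^sup>+\<^sup>1\<close>, \<open>u\<^sub>f\<^sup>n\<^sup>+\<^sup>1\<close>,
  \<open>\<phi>\<^sup>n\<^sup>+\<^sup>1 - \<phi>\<^sup>n\<close> and \<open>p\<^sup>n\<^sup>+\<^sup>1\<close>, the upwind terms and the Biot coupling terms cancel, and the energy increment is bounded by
  \<open>- B(w, w) / 2\<close> minus nonnegative dissipation terms. Finally \<open>B(w, w) \<ge> 0\<close> for large penalty: the
  stress of a piecewise linear field is constant on each element, so Young's inequality reduces the
  claim to \<open>h\<^sub>e\<^sup>2 \<le> C |K|\<close> for the faces \<open>e\<close> of \<open>K\<close>.\<close>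

section \<open>The free energy density\<close>

text \<open>The two terms 1 / c and b / (1 - b * c) + b / (1 - b * c)^2 of the second derivative
  combine to exactly 1 / (c * (1 - b * c)^2), the weight that the stabilized potential divides
  by.\<close>

lemma ideal_has_derivative:
  fixes c b :: real
  assumes "0 < c" "b * c < 1"
  shows "((\<lambda>c. c * ln c - c * ln (1 - b * c)) has_real_derivative
           ln c + 1 - ln (1 - b * c) + b * c / (1 - b * c)) (at c)"
    and "((\<lambda>c. ln c + 1 - ln (1 - b * c) + b * c / (1 - b * c)) has_real_derivative
           1 / (c * (1 - b * c)\<^sup>2)) (at c)"
proof -
  show "((\<lambda>c. c * ln c - c * ln (1 - b * c)) has_real_derivative
           ln c + 1 - ln (1 - b * c) + b * c / (1 - b * c)) (at c)"
    using assms by (auto intro!: derivative_eq_intros simp: field_simps)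
  have "((\<lambda>c. ln c + 1 - ln (1 - b * c) + b * c / (1 - b * c)) has_real_derivative
           1 / c + b / (1 - b * c) + b / (1 - b * c)\<^sup>2) (at c)"
  proof -
    have frac: "((\<lambda>c. b * c / (1 - b * c)) has_real_derivative b / (1 - b * c)\<^sup>2) (at c)"
      using assms by (auto intro!: derivative_eq_intros simp: power2_eq_square algebra_simps)
    have lnd: "((\<lambda>c. ln (1 - b * c)) has_real_derivative - (b / (1 - b * c))) (at c)"
      using assms by (auto intro!: derivative_eq_intros)
    have ln1: "((\<lambda>c. ln c + 1) has_real_derivative 1 / c) (at c)"
      using assms by (auto intro!: derivative_eq_intros)
    show ?thesis
      using DERIV_add[OF DERIV_diff[OF ln1 lnd] frac] by simp
  qed
  moreover have "1 / c + b / (1 - b * c) + b / (1 - b * c)\<^sup>2 = 1 / (c * (1 - b * c)\<^sup>2)"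
    using assms by (simp add: divide_simps power2_eq_square)
  ultimately show "((\<lambda>c. ln c + 1 - ln (1 - b * c) + b * c / (1 - b * c)) has_real_derivative
           1 / (c * (1 - b * c)\<^sup>2)) (at c)"
    by simp
qed

text \<open>The argument of the logarithm in the Peng-Robinson attraction term.\<close>

definition pr_quotient :: "real \<Rightarrow> real \<Rightarrow> real" where
  "pr_quotient b c = (1 + (1 - sqrt 2) * b * c) / (1 + (1 + sqrt 2) * b * c)"

text \<open>The factors vanish at 1 + sqrt 2 and 1 - sqrt 2, both outside [0, 1). Their product is
  the Peng-Robinson denominator because (1 - sqrt 2) * (1 + sqrt 2) = -1.\<close>

lemma pr_factors:
  fixes x :: real
  assumes "0 \<le> x" "x < 1"
  shows "1 + (1 - sqrt 2) * x > 0" "1 + (1 + sqrt 2) * x > 0" "1 + 2 * x - x\<^sup>2 > 0"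
    "(1 + (1 - sqrt 2) * x) * (1 + (1 + sqrt 2) * x) = 1 + 2 * x - x\<^sup>2"
proof -
  have s: "sqrt 2 * sqrt 2 = (2::real)" "sqrt 2 < 2" "sqrt 2 > 0"
    by (auto intro: real_less_lsqrt)
  have "(sqrt 2 - 1) * x \<le> (sqrt 2 - 1) * 1"
    using assms by (intro mult_left_mono) auto
  then show 1: "1 + (1 - sqrt 2) * x > 0"
    using s(2) by (simp add: algebra_simps)
  show 2: "1 + (1 + sqrt 2) * x > 0"
    using assms s by (smt (verit) mult_nonneg_nonneg)
  show 3: "(1 + (1 - sqrt 2) * x) * (1 + (1 + sqrt 2) * x) = 1 + 2 * x - x\<^sup>2"
    using s(1) by (simp add: algebra_simps power2_eq_square)
  show "1 + 2 * x - x\<^sup>2 > 0" using 1 2 3 by (metis mult_pos_pos)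
qed

text \<open>Differentiating the logarithm gives - 2 * sqrt 2 * b / D with \<open>D = p * q\<close>,
  which cancels the prefactor and leaves a rational function. Both terms of the second derivative
  are negative, so attraction can only lower the curvature of the free energy.\<close>

lemma attraction_has_derivative:
  fixes c b :: real
  assumes "0 < c" "0 < b" "b * c < 1"
  shows "((\<lambda>c. c / (2 * sqrt 2 * b) * ln (pr_quotient b c)) has_real_derivative
           ln (pr_quotient b c) / (2 * sqrt 2 * b) - c / (1 + 2 * (b * c) - (b * c)\<^sup>2)) (at c)"
    and "((\<lambda>c. ln (pr_quotient b c) / (2 * sqrt 2 * b) - c / (1 + 2 * (b * c) - (b * c)\<^sup>2))
           has_real_derivative
           - 1 / (1 + 2 * (b * c) - (b * c)\<^sup>2)
           - (1 + (b * c)\<^sup>2) / (1 + 2 * (b * c) - (b * c)\<^sup>2)\<^sup>2) (at c)"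
proof -
  define D where "D = 1 + 2 * (b * c) - (b * c)\<^sup>2"
  define p where "p = 1 + (1 - sqrt 2) * (b * c)"
  define q where "q = 1 + (1 + sqrt 2) * (b * c)"
  have pq: "p > 0" "q > 0" "D > 0" "p * q = D"
    using pr_factors[of "b * c"] assms by (auto simp: p_def q_def D_def)
  have quot: "pr_quotient b c = p / q" by (simp add: pr_quotient_def p_def q_def mult.assoc)
  have dp: "((\<lambda>c. 1 + (1 - sqrt 2) * b * c) has_real_derivative (1 - sqrt 2) * b) (at c)"
    by (auto intro!: derivative_eq_intros)
  have dq: "((\<lambda>c. 1 + (1 + sqrt 2) * b * c) has_real_derivative (1 + sqrt 2) * b) (at c)"
    by (auto intro!: derivative_eq_intros)
  have dquot: "(pr_quotient b has_real_derivative (- 2 * sqrt 2 * b) / q\<^sup>2) (at c)"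
  proof -
    have "((\<lambda>c. (1 + (1 - sqrt 2) * b * c) / (1 + (1 + sqrt 2) * b * c)) has_real_derivative
      ((1 - sqrt 2) * b * q - p * ((1 + sqrt 2) * b)) / (q * q)) (at c)"
      using DERIV_divide[OF dp dq] pq by (simp add: p_def q_def mult.assoc)
    moreover have "(1 - sqrt 2) * b * q - p * ((1 + sqrt 2) * b) = - 2 * sqrt 2 * b"
      by (simp add: p_def q_def algebra_simps)
    ultimately show ?thesis
      by (simp add: pr_quotient_def[abs_def] power2_eq_square)
  qed
  have dln: "((\<lambda>c. ln (pr_quotient b c)) has_real_derivative - 2 * sqrt 2 * b / D) (at c)"
  proof -
    have "((\<lambda>c. ln (pr_quotient b c)) has_real_derivative
        1 / (p / q) * ((- 2 * sqrt 2 * b) / q\<^sup>2)) (at c)"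
      using DERIV_chain2[OF DERIV_ln_divide dquot] pq by (simp add: quot)
    moreover have "1 / (p / q) * ((- 2 * sqrt 2 * b) / q\<^sup>2) = - 2 * sqrt 2 * b / D"
      using pq(1,2) unfolding pq(4)[symmetric] by (simp add: power2_eq_square)
    ultimately show ?thesis by simp
  qed
  show "((\<lambda>c. c / (2 * sqrt 2 * b) * ln (pr_quotient b c)) has_real_derivative
           ln (pr_quotient b c) / (2 * sqrt 2 * b) - c / (1 + 2 * (b * c) - (b * c)\<^sup>2)) (at c)"
  proof -
    have "((\<lambda>c. c / (2 * sqrt 2 * b)) has_real_derivative 1 / (2 * sqrt 2 * b)) (at c)"
      using assms(2) by (auto intro!: derivative_eq_intros)
    from DERIV_mult[OF this dln]
    have "((\<lambda>c. c / (2 * sqrt 2 * b) * ln (pr_quotient b c)) has_real_derivative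
      1 / (2 * sqrt 2 * b) * ln (pr_quotient b c) + (- 2 * sqrt 2 * b / D) * (c / (2 * sqrt 2 * b))) (at c)" .
    moreover have "1 / (2 * sqrt 2 * b) * ln (pr_quotient b c) + (- 2 * sqrt 2 * b / D) * (c / (2 * sqrt 2 * b))
        = ln (pr_quotient b c) / (2 * sqrt 2 * b) - c / D"
      using assms(2) by simp
    ultimately show ?thesis unfolding D_def by simp
  qed
  have D': "D = 1 + 2 * (b * c) - (b * c)\<^sup>2" by (rule D_def)
  have "((\<lambda>c. c / (1 + 2 * (b * c) - (b * c)\<^sup>2)) has_real_derivative
      (D - c * (2 * b - 2 * b * (b * c))) / (D * D)) (at c)"
    unfolding D_def
    using pq(3)[unfolded D_def] by (auto intro!: derivative_eq_intros)
  moreover have "D - c * (2 * b - 2 * b * (b * c)) = 1 + (b * c)\<^sup>2"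
    by (simp add: D' power2_eq_square algebra_simps)
  ultimately have dfrac: "((\<lambda>c. c / (1 + 2 * (b * c) - (b * c)\<^sup>2)) has_real_derivative
      (1 + (b * c)\<^sup>2) / D\<^sup>2) (at c)"
    by (simp add: power2_eq_square)
  show "((\<lambda>c. ln (pr_quotient b c) / (2 * sqrt 2 * b) - c / (1 + 2 * (b * c) - (b * c)\<^sup>2))
           has_real_derivative
           - 1 / (1 + 2 * (b * c) - (b * c)\<^sup>2)
           - (1 + (b * c)\<^sup>2) / (1 + 2 * (b * c) - (b * c)\<^sup>2)\<^sup>2) (at c)"
    using DERIV_diff[OF DERIV_cdivide[OF dln, of "2 * sqrt 2 * b"] dfrac] assms(2)
    unfolding D_def by simp
qed

text \<open>If the value at \<open>y\<close> lay below both end values, the divided difference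
  \<open>g\<close>, a quadratic in t with leading coefficient 1, would satisfy g a < 0 < g b. But g
  1 = y * (y - 1) < 0, so convexity of \<open>g\<close> on [a, 1] forces g b <= 0.\<close>

lemma cubic_quasiconcave:
  fixes a y b :: real
  assumes "0 < a" "a \<le> y" "y \<le> b" "b < 1"
  shows "min (a * (1 - a)\<^sup>2) (b * (1 - b)\<^sup>2) \<le> y * (1 - y)\<^sup>2"
proof (rule ccontr)
  assume "\<not> ?thesis"
  then have la: "y * (1 - y)\<^sup>2 < a * (1 - a)\<^sup>2" and lb: "y * (1 - y)\<^sup>2 < b * (1 - b)\<^sup>2"
    by auto
  define g where "g t = 1 - 2 * (y + t) + y\<^sup>2 + y * t + t\<^sup>2" for t
  have diff: "y * (1 - y)\<^sup>2 - t * (1 - t)\<^sup>2 = (y - t) * g t" for t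
    by (simp add: g_def power2_eq_square algebra_simps)
  have "(y - a) * g a < 0" using diff[of a] la by simp
  then have "g a < 0" using assms by (simp add: mult_less_0_iff)
  have "(y - b) * g b < 0" using diff[of b] lb by simp
  then have "g b > 0" using assms by (simp add: mult_less_0_iff)
  have "g 1 < 0" using assms mult_strict_right_mono[of y 1 y] by (auto simp: g_def power2_eq_square)
  \<comment> \<open>Interpolation of \<open>g\<close> between \<open>a\<close> and 1; the last term
    is the exact convexity defect of a monic quadratic.\<close>
  have "(1 - a) * g b = (1 - b) * g a + (b - a) * g 1 - (b - a) * (1 - b) * (1 - a)"
    by (simp add: g_def power2_eq_square algebra_simps)
  also have "\<dots> \<le> 0"
  proof -
    have "(1 - b) * g a \<le> 0" "(b - a) * g 1 \<le> 0" "(b - a) * (1 - b) * (1 - a) \<ge> 0"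
      using assms \<open>g a < 0\<close> \<open>g 1 < 0\<close> by (simp_all add: mult_nonneg_nonpos)
    then show ?thesis by linarith
  qed
  finally show False using \<open>g b > 0\<close> assms by (simp add: mult_le_0_iff)
qed

section \<open>Curvature of the free energy and the increment estimate\<close>

lemma free_energy_eq:
  "free_energy P = (\<lambda>c. gasR P * temp P * (c * ln c - c * ln (1 - covol P * c))
     + attr P * (c / (2 * sqrt 2 * covol P) * ln (pr_quotient (covol P) c)))"
  by (auto simp: free_energy_def pr_quotient_def algebra_simps)

text \<open>\<open>chem_pot\<close> is given through \<open>deriv\<close>, which carries information
  only where differentiability is known. This closed form is what gets differentiated a second
  time.\<close>

definition chem_pot_formula :: "params \<Rightarrow> real \<Rightarrow> real" where
  "chem_pot_formula P c =
     gasR P * temp P * (ln c + 1 - ln (1 - covol P * c) + covol P * c / (1 - covol P * c))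
     + attr P * (ln (pr_quotient (covol P) c) / (2 * sqrt 2 * covol P)
         - c / (1 + 2 * (covol P * c) - (covol P * c)\<^sup>2))"

lemma free_energy_derivatives:
  assumes "admissible_params P" "0 < c" "covol P * c < 1"
  shows "(free_energy P has_real_derivative chem_pot_formula P c) (at c)"
    and "\<exists>m. (chem_pot_formula P has_real_derivative m) (at c)
           \<and> m \<le> gasR P * temp P / (c * (1 - covol P * c)\<^sup>2)"
proof -
  have pos: "covol P > 0" "attr P > 0" using assms by (auto simp: admissible_params_def)
  show "(free_energy P has_real_derivative chem_pot_formula P c) (at c)"
    unfolding free_energy_eq chem_pot_formula_def
    using ideal_has_derivative(1)[OF assms(2,3)] attraction_has_derivative(1)[OF assms(2) pos(1) assms(3)]
    by (intro DERIV_add DERIV_cmult)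
  define D where "D = 1 + 2 * (covol P * c) - (covol P * c)\<^sup>2"
  have "D > 0"
    using pr_factors(3)[of "covol P * c"] assms pos by (simp add: D_def)
  define m where "m = gasR P * temp P * (1 / (c * (1 - covol P * c)\<^sup>2))
    + attr P * (- 1 / D - (1 + (covol P * c)\<^sup>2) / D\<^sup>2)"
  have "(chem_pot_formula P has_real_derivative m) (at c)"
    unfolding chem_pot_formula_def[abs_def] m_def D_def
    using ideal_has_derivative(2)[OF assms(2,3)] attraction_has_derivative(2)[OF assms(2) pos(1) assms(3)]
    by (intro DERIV_add DERIV_cmult)
  moreover have "attr P * (- 1 / D - (1 + (covol P * c)\<^sup>2) / D\<^sup>2) \<le> 0"
  proof (rule mult_nonneg_nonpos)
    have "- 1 / D \<le> 0" "(1 + (covol P * c)\<^sup>2) / D\<^sup>2 \<ge> 0" using \<open>D > 0\<close> by auto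
    then show "- 1 / D - (1 + (covol P * c)\<^sup>2) / D\<^sup>2 \<le> 0" by linarith
  qed (use pos in simp)
  ultimately show "\<exists>m. (chem_pot_formula P has_real_derivative m) (at c)
           \<and> m \<le> gasR P * temp P / (c * (1 - covol P * c)\<^sup>2)"
    by (intro exI[of _ m]) (auto simp: m_def)
qed

lemma chem_pot_eq:
  assumes "admissible_params P" "0 < c" "covol P * c < 1"
  shows "chem_pot P c = chem_pot_formula P c"
  unfolding chem_pot_def by (rule DERIV_imp_deriv[OF free_energy_derivatives(1)[OF assms]])

text \<open>With \<open>L\<close> the coefficient of the stabilization, L * c^2 / 2 - f(c) is convex
  on the interval of admissible concentrations. Its tangent at \<open>c0\<close> bounds the
  increment of f with remainder L / 2 * (c1 - c0)^2, half of what the stabilization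
  supplies.\<close>

lemma free_energy_increment_le:
  assumes P: "admissible_params P"
    and c: "0 < c0" "covol P * c0 < 1" "0 < k1" "k1 \<le> 1" "1 \<le> k2" "k2 * (covol P * c0) < 1"
    and c1: "k1 * c0 \<le> c1" "c1 \<le> k2 * c0"
    and \<theta>: "(1 - covol P * c0)\<^sup>2 / (k1 * (1 - k1 * covol P * c0)\<^sup>2) \<le> \<theta>"
      "(1 - covol P * c0)\<^sup>2 / (k2 * (1 - k2 * covol P * c0)\<^sup>2) \<le> \<theta>"
  shows "free_energy P c1 - free_energy P c0 \<le>
    (chem_pot P c0 + \<theta> * gasR P * temp P * (c1 - c0) / (c0 * (1 - covol P * c0)\<^sup>2)) * (c1 - c0)"
proof -
  define b where "b = covol P"
  have pos: "b > 0" "gasR P > 0" "temp P > 0" using P by (auto simp: admissible_params_def b_def)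
  define h where "h x = x * (1 - b * x)\<^sup>2" for x
  define L where "L = \<theta> * gasR P * temp P / h c0"
  have range: "0 < x" "b * x < 1" if "x \<in> {k1 * c0..k2 * c0}" for x
  proof -
    have "0 < k1 * c0" using c(1,3) by simp
    then show "0 < x" using that by simp
    have "b * x \<le> b * (k2 * c0)" using that pos by (intro mult_left_mono) auto
    then show "b * x < 1" using c(6) by (simp add: b_def mult_ac)
  qed
  have c0: "c0 \<in> {k1 * c0..k2 * c0}" using c(1,4,5) by simp
  have c1: "c1 \<in> {k1 * c0..k2 * c0}" using c1 by auto
  have h0: "h x > 0" if "x \<in> {k1 * c0..k2 * c0}" for x
    using range[OF that] by (simp add: h_def)
  \<comment> \<open>At an end point \<open>k * c0\<close> the condition on \<open>\<theta>\<close>,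
    cleared of its denominator and multiplied by \<open>c0\<close>, compares \<open>h\<close> at
    \<open>c0\<close> with \<open>h\<close> at that end point.\<close>
  have \<theta>k: "h c0 \<le> \<theta> * h (k * c0)"
    if "(1 - covol P * c0)\<^sup>2 / (k * (1 - k * covol P * c0)\<^sup>2) \<le> \<theta>" "k * c0 \<in> {k1 * c0..k2 * c0}" for k
  proof -
    have "k > 0" using range[OF that(2)] c(1) by (simp add: zero_less_mult_iff)
    have "1 - k * b * c0 > 0" using range[OF that(2)] by (simp add: mult_ac)
    then have "k * (1 - k * covol P * c0)\<^sup>2 > 0" using \<open>k > 0\<close> by (simp add: b_def)
    then have "(1 - b * c0)\<^sup>2 \<le> \<theta> * (k * (1 - k * b * c0)\<^sup>2)"
      using that(1) by (simp add: b_def pos_divide_le_eq)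
    then have "c0 * (1 - b * c0)\<^sup>2 \<le> c0 * (\<theta> * (k * (1 - k * b * c0)\<^sup>2))"
      using c(1) by (intro mult_left_mono) auto
    then show ?thesis by (simp add: h_def mult_ac)
  qed
  have ends: "k1 * c0 \<in> {k1 * c0..k2 * c0}" "k2 * c0 \<in> {k1 * c0..k2 * c0}" using c0 by auto
  have "0 < h c0" using h0 c0 .
  then have "\<theta> > 0"
    using \<theta>k[OF \<theta>(1) ends(1)] h0[OF ends(1)] by (smt (verit) mult_nonneg_nonpos mult.commute)
  have hmin: "h c0 \<le> \<theta> * h x" if x: "x \<in> {k1 * c0..k2 * c0}" for x
  proof -
    \<comment> \<open>Scaling by \<open>b\<close> turns \<open>h\<close> into the cubic y * (1 -
      y)^2 at y = b * x.\<close>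
    have "min (b * (k1 * c0) * (1 - b * (k1 * c0))\<^sup>2) (b * (k2 * c0) * (1 - b * (k2 * c0))\<^sup>2)
        \<le> b * x * (1 - b * x)\<^sup>2"
      using x range[OF ends(1)] range[OF ends(2)] pos(1) by (intro cubic_quasiconcave) auto
    then have "min (b * h (k1 * c0)) (b * h (k2 * c0)) \<le> b * h x"
      by (simp add: h_def mult.assoc)
    then have "h (k1 * c0) \<le> h x \<or> h (k2 * c0) \<le> h x"
      using pos(1) by (auto simp: min_le_iff_disj)
    then have "\<theta> * h (k1 * c0) \<le> \<theta> * h x \<or> \<theta> * h (k2 * c0) \<le> \<theta> * h x"
      using \<open>\<theta> > 0\<close> by auto
    then show ?thesis
      using \<theta>k[OF \<theta>(1) ends(1)] \<theta>k[OF \<theta>(2) ends(2)] by linarith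
  qed
  have curv: "gasR P * temp P / h x \<le> L" if x: "x \<in> {k1 * c0..k2 * c0}" for x
  proof -
    have "gasR P * temp P * h c0 \<le> gasR P * temp P * (\<theta> * h x)"
      using hmin[OF x] pos by (intro mult_left_mono) auto
    then show ?thesis
      using h0[OF x] h0[OF c0] by (simp add: L_def divide_simps mult_ac)
  qed
  have "\<forall>x\<in>{k1 * c0..k2 * c0}. \<exists>m. (chem_pot_formula P has_real_derivative m) (at x)
           \<and> m \<le> gasR P * temp P / h x"
    using free_energy_derivatives(2)[OF P] range unfolding h_def b_def by blast
  from bchoice[OF this] obtain m
    where m: "\<And>x. x \<in> {k1 * c0..k2 * c0} \<Longrightarrow> (chem_pot_formula P has_real_derivative m x) (at x)"
      "\<And>x. x \<in> {k1 * c0..k2 * c0} \<Longrightarrow> m x \<le> gasR P * temp P / h x"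
    by blast
  \<comment> \<open>The tangent inequality at \<open>c0\<close> for a function whose second
    derivative \<open>L - m x\<close> is nonnegative.\<close>
  have "(L * c0 - chem_pot_formula P c0) * (c1 - c0)
      \<le> (L * c1\<^sup>2 / 2 - free_energy P c1) - (L * c0\<^sup>2 / 2 - free_energy P c0)"
  proof (rule f''_imp_f'[where f'' = "\<lambda>x. L - m x"])
    fix x assume x: "x \<in> {k1 * c0..k2 * c0}"
    show "((\<lambda>c. L * c\<^sup>2 / 2 - free_energy P c) has_real_derivative L * x - chem_pot_formula P x) (at x)"
      using range[OF x] by (auto intro!: derivative_eq_intros free_energy_derivatives(1)[OF P] simp: b_def)
    show "((\<lambda>x. L * x - chem_pot_formula P x) has_real_derivative L - m x) (at x)"
      by (auto intro!: derivative_eq_intros m(1)[OF x])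
    show "0 \<le> L - m x" using m(2)[OF x] curv[OF x] by linarith
  qed (use c0 c1 in auto)
  then have "free_energy P c1 - free_energy P c0
      \<le> chem_pot_formula P c0 * (c1 - c0) + L / 2 * (c1 - c0)\<^sup>2"
    by (simp add: field_simps power2_eq_square)
  also have "\<dots> \<le> chem_pot_formula P c0 * (c1 - c0) + L * (c1 - c0)\<^sup>2"
  proof -
    have "L \<ge> 0" using \<open>\<theta> > 0\<close> pos \<open>0 < h c0\<close> by (simp add: L_def)
    then have "L / 2 * (c1 - c0)\<^sup>2 \<le> L * (c1 - c0)\<^sup>2" by (intro mult_right_mono) auto
    then show ?thesis by simp
  qed
  also have "\<dots> = (chem_pot P c0 + \<theta> * gasR P * temp P * (c1 - c0) / (c0 * (1 - covol P * c0)\<^sup>2)) * (c1 - c0)"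
    using chem_pot_eq[OF P c(1,2)]
    by (simp add: L_def h_def b_def distrib_right power2_eq_square[of "c1 - c0"])
  finally show ?thesis .
qed

section \<open>Face sizes and integrals\<close>

lemma sets_hyperplane_measure [simp]: "sets (hyperplane_measure n s) = sets borel"
  by (simp add: hyperplane_measure_def)

lemma emeasure_hyperplane_measure:
  assumes "A \<in> sets borel"
  shows "emeasure (hyperplane_measure n s) A =
    emeasure lborel {x. s \<le> n \<bullet> x \<and> n \<bullet> x \<le> s + 1 \<and> x - (n \<bullet> x - s) *\<^sub>R n \<in> A}" (is "_ = emeasure _ ?S")
proof -
  let ?slab = "{x. s \<le> n \<bullet> x \<and> n \<bullet> x \<le> s + 1}"
  let ?proj = "\<lambda>x. x - (n \<bullet> x - s) *\<^sub>R n"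
  have slab: "?slab \<in> sets borel" by measurable
  have proj: "?proj \<in> borel_measurable borel" by measurable
  have "?proj \<in> measurable (restrict_space lborel ?slab) borel"
    by (rule measurable_restrict_space1) (use proj in simp)
  then have "emeasure (hyperplane_measure n s) A
      = emeasure (restrict_space lborel ?slab) (?proj -` A \<inter> ?slab)"
    using assms unfolding hyperplane_measure_def
    by (subst emeasure_distr) (auto simp: space_restrict_space)
  also have "\<dots> = emeasure lborel (?proj -` A \<inter> ?slab)"
    using slab by (intro emeasure_restrict_space) auto
  also have "?proj -` A \<inter> ?slab = ?S" by auto
  finally show ?thesis .
qed

text \<open>The right prism of height 1 over a set of diameter \<open>\<delta>\<close> is covered by \<open>1/\<delta> + 1\<close> balls of
  radius \<open>2\<delta>\<close>, centred on a segment of length 1.\<close>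

lemma hyperplane_measure_le:
  fixes n y :: "real ^ 'd::finite"
  assumes n: "norm n = 1" and A: "A \<in> sets borel" "A \<subseteq> cball y \<delta>" and \<delta>: "\<delta> > 0"
  shows "emeasure (hyperplane_measure n s) A < \<infinity>"
    and "measure (hyperplane_measure n s) A \<le>
      unit_ball_vol CARD('d) * 2 ^ CARD('d) * (1 + \<delta>) * \<delta> ^ (CARD('d) - 1)"
proof -
  let ?S = "{x. s \<le> n \<bullet> x \<and> n \<bullet> x \<le> s + 1 \<and> x - (n \<bullet> x - s) *\<^sub>R n \<in> A}"
  define m where "m = nat \<lfloor>1 / \<delta>\<rfloor>"
  define B where "B j = cball (y + (real j * \<delta>) *\<^sub>R n) (2 * \<delta>)" for j
  have B: "B j \<in> fmeasurable lborel" for j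
    using emeasure_lborel_cball_finite by (auto simp: B_def fmeasurable_def)
  have sub: "?S \<subseteq> (\<Union>j\<in>{..m}. B j)"
  proof
    fix x assume x: "x \<in> ?S"
    define t where "t = n \<bullet> x - s"
    \<comment> \<open>The height \<open>t\<close> over the hyperplane is rounded down to a multiple
      of \<open>\<delta>\<close>. The projection is within \<open>\<delta>\<close> of
      \<open>y\<close> and rounding costs at most another \<open>\<delta>\<close>, hence the radius
      2 * \<delta>.\<close>
    define j where "j = nat \<lfloor>t / \<delta>\<rfloor>"
    have t: "0 \<le> t" "t \<le> 1" using x by (auto simp: t_def)
    have "t / \<delta> \<le> 1 / \<delta>" using t \<delta> by (simp add: divide_right_mono)
    then have "j \<in> {..m}" by (auto simp: j_def m_def intro!: nat_mono floor_mono)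
    moreover have "x \<in> B j"
    proof -
      have "real j = of_int \<lfloor>t / \<delta>\<rfloor>" using t \<delta> by (simp add: j_def)
      then have "real j \<le> t / \<delta>" "t / \<delta> < real j + 1" by linarith+
      then have "real j * \<delta> \<le> t" "t < (real j + 1) * \<delta>"
        using \<delta> by (simp_all add: pos_le_divide_eq pos_divide_less_eq)
      then have tj: "\<bar>t - real j * \<delta>\<bar> \<le> \<delta>" by (auto simp: algebra_simps)
      have "x - t *\<^sub>R n \<in> cball y \<delta>" using x A by (auto simp: t_def)
      then have "norm (x - t *\<^sub>R n - y) \<le> \<delta>" by (simp add: dist_norm norm_minus_commute)
      moreover have "norm ((t - real j * \<delta>) *\<^sub>R n) \<le> \<delta>" using tj n by simp
      ultimately have "norm ((x - t *\<^sub>R n - y) + (t - real j * \<delta>) *\<^sub>R n) \<le> 2 * \<delta>"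
        by (smt (verit) norm_triangle_ineq)
      moreover have "(x - t *\<^sub>R n - y) + (t - real j * \<delta>) *\<^sub>R n = x - (y + (real j * \<delta>) *\<^sub>R n)"
        by (simp add: algebra_simps)
      ultimately show ?thesis by (simp add: B_def dist_norm norm_minus_commute)
    qed
    ultimately show "x \<in> (\<Union>j\<in>{..m}. B j)" by blast
  qed
  have U: "(\<Union>j\<in>{..m}. B j) \<in> fmeasurable lborel"
    using B by (intro fmeasurable.finite_UN) auto
  have "(\<lambda>x. x - (n \<bullet> x - s) *\<^sub>R n) \<in> borel_measurable borel" by measurable
  from measurable_sets_borel[OF this A(1)]
  have "(\<lambda>x. x - (n \<bullet> x - s) *\<^sub>R n) -` A \<in> sets borel" by simp
  moreover have "{x. s \<le> n \<bullet> x \<and> n \<bullet> x \<le> s + 1} \<in> sets borel" by measurable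
  moreover have "?S = (\<lambda>x. x - (n \<bullet> x - s) *\<^sub>R n) -` A \<inter> {x. s \<le> n \<bullet> x \<and> n \<bullet> x \<le> s + 1}"
    by auto
  ultimately have S: "?S \<in> sets borel" by simp
  have "emeasure lborel ?S \<le> emeasure lborel (\<Union>j\<in>{..m}. B j)"
    using U sub by (intro emeasure_mono) (auto simp: fmeasurable_def)
  also have "\<dots> < \<infinity>" using U by (simp add: fmeasurable_def)
  finally show "emeasure (hyperplane_measure n s) A < \<infinity>"
    by (simp add: emeasure_hyperplane_measure[OF A(1)])
  have "measure (hyperplane_measure n s) A = measure lborel ?S"
    by (simp add: measure_def emeasure_hyperplane_measure[OF A(1)])
  also have "\<dots> \<le> measure lborel (\<Union>j\<in>{..m}. B j)"
    using U sub S by (intro measure_mono_fmeasurable) auto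
  also have "\<dots> \<le> (\<Sum>j\<in>{..m}. measure lborel (B j))"
    using B by (intro measure_UNION_le) (auto simp: fmeasurable_def)
  also have "\<dots> = real (m + 1) * (unit_ball_vol CARD('d) * (2 * \<delta>) ^ CARD('d))"
    using \<delta> by (simp add: B_def content_cball)
  also have "\<dots> \<le> (1 / \<delta> + 1) * (unit_ball_vol CARD('d) * (2 * \<delta>) ^ CARD('d))"
  proof (rule mult_right_mono)
    have "0 \<le> 1 / \<delta>" using \<delta> by simp
    then show "real (m + 1) \<le> 1 / \<delta> + 1" unfolding m_def by linarith
  qed (use \<delta> in simp)
  \<comment> \<open>One factor \<open>\<delta>\<close> cancels against 1 / \<delta>, leaving the
    power d - 1 that a surface measure must have.\<close>
  also have "\<dots> = unit_ball_vol CARD('d) * 2 ^ CARD('d) * (1 + \<delta>) * \<delta> ^ (CARD('d) - 1)"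
  proof -
    have "\<delta> ^ CARD('d) = \<delta> * \<delta> ^ (CARD('d) - 1)"
      by (metis power_eq_if zero_less_card_finite less_numeral_extra(3))
    then show ?thesis using \<delta> by (simp add: power_mult_distrib field_simps)
  qed
  finally show "measure (hyperplane_measure n s) A \<le>
      unit_ball_vol CARD('d) * 2 ^ CARD('d) * (1 + \<delta>) * \<delta> ^ (CARD('d) - 1)" .
qed

text \<open>Every face is the convex hull of a subset of the n + 1 vertices, and there are 2^(n + 1)
  such subsets.\<close>

lemma card_faces_simplex_le:
  assumes "n simplex K"
  shows "finite {F. F face_of K}" and "int (card {F. F face_of K}) \<le> 2 ^ nat (n + 1)"
proof -
  obtain C where C: "finite C" "int (card C) = n + 1" "K = convex hull C"
    using assms unfolding simplex by blast
  have sub: "{F. F face_of K} \<subseteq> (\<lambda>S. convex hull S) ` Pow C"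
  proof
    fix F assume "F \<in> {F. F face_of K}"
    then have "F face_of convex hull C" using C by simp
    from face_of_convex_hull_subset[OF finite_imp_compact[OF C(1)] this]
    obtain S where "S \<subseteq> C" "F = convex hull S" by metis
    then show "F \<in> (\<lambda>S. convex hull S) ` Pow C" by blast
  qed
  show "finite {F. F face_of K}"
    using sub C(1) by (meson finite_Pow_iff finite_imageI finite_subset)
  have "card {F. F face_of K} \<le> card (Pow C)"
    using sub C(1) by (meson card_image_le card_mono finite_Pow_iff finite_imageI le_trans)
  also have "\<dots> = 2 ^ nat (n + 1)"
    using C by (simp add: card_Pow flip: C(2))
  finally show "int (card {F. F face_of K}) \<le> 2 ^ nat (n + 1)"
    by (metis of_nat_le_iff of_nat_numeral of_nat_power)
qed

section \<open>Counting and measuring the cells and faces of a mesh\<close>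

locale valid_mesh =
  fixes M :: "'d::finite mesh"
  assumes mesh: "simplicial_mesh M"
begin

lemma finite_cells: "finite (cells M)"
  using mesh by (auto simp: simplicial_mesh_def triangulation_def)

lemma finite_interior_faces: "finite (interior_faces M)"
proof -
  have "interior_faces M \<subseteq> (\<lambda>(K, K'). K \<inter> K') ` (cells M \<times> cells M)"
    by (auto simp: interior_faces_def)
  then show ?thesis using finite_cells by (meson finite_SigmaI finite_imageI finite_subset)
qed

lemma compact_cell: "K \<in> cells M \<Longrightarrow> compact K"
  using mesh polytope_imp_compact simplex_imp_polytope unfolding simplicial_mesh_def by blast

lemma cell_fmeasurable: "K \<in> cells M \<Longrightarrow> K \<in> fmeasurable lborel"
  using compact_cell fmeasurable_compact by blast

lemma face_cells:
  assumes "e \<in> interior_faces M"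
  shows "cell_i M e \<in> cells M" "cell_j M e \<in> cells M" "e = cell_i M e \<inter> cell_j M e"
    "norm (unit_normal M e) = 1"
  using mesh assms by (auto simp: simplicial_mesh_def)

text \<open>The cells that witness membership in \<open>interior_faces\<close> need not be the ones
  chosen by \<open>cell_i\<close> and \<open>cell_j\<close>. The face property is therefore taken
  from the triangulation, where any two cells meet in a common face.\<close>

lemma face_of_cells:
  assumes "e \<in> interior_faces M"
  shows "e face_of cell_i M e" "e face_of cell_j M e"
proof -
  have "\<forall>T T'. T \<in> cells M \<and> T' \<in> cells M \<longrightarrow> (T \<inter> T') face_of T"
    using mesh by (simp add: simplicial_mesh_def triangulation_def)
  then show "e face_of cell_i M e" "e face_of cell_j M e"
    using face_cells[OF assms] by (metis inf_commute)+
qed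

lemma compact_face: "e \<in> interior_faces M \<Longrightarrow> compact e"
  using face_cells compact_cell by (metis compact_Int)

lemma card_faces_le:
  assumes "K \<in> cells M"
  shows "finite {e \<in> interior_faces M. cell_i M e = K}"
    and "real (card {e \<in> interior_faces M. cell_i M e = K}) \<le> 2 ^ (CARD('d) + 1)"
    and "finite {e \<in> interior_faces M. cell_j M e = K}"
    and "real (card {e \<in> interior_faces M. cell_j M e = K}) \<le> 2 ^ (CARD('d) + 1)"
proof -
  have K: "int CARD('d) simplex K" using mesh assms by (simp add: simplicial_mesh_def)
  note fin = card_faces_simplex_le(1)[OF K]
  have "int (card {F. F face_of K}) \<le> int (2 ^ (CARD('d) + 1))"
    using card_faces_simplex_le(2)[OF K] by (simp add: nat_add_distrib)
  then have le: "card {F. F face_of K} \<le> 2 ^ (CARD('d) + 1)" by linarith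
  have "real (card S) \<le> 2 ^ (CARD('d) + 1) \<and> finite S" if "S \<subseteq> {F. F face_of K}" for S
  proof -
    have "card S \<le> 2 ^ (CARD('d) + 1)" using card_mono[OF fin that] le by linarith
    then have "real (card S) \<le> real (2 ^ (CARD('d) + 1))" by (rule of_nat_mono)
    then show ?thesis using finite_subset[OF that fin] by simp
  qed
  moreover have "{e \<in> interior_faces M. cell_i M e = K} \<subseteq> {F. F face_of K}"
    "{e \<in> interior_faces M. cell_j M e = K} \<subseteq> {F. F face_of K}"
    using face_of_cells by auto
  ultimately show "finite {e \<in> interior_faces M. cell_i M e = K}"
    "real (card {e \<in> interior_faces M. cell_i M e = K}) \<le> 2 ^ (CARD('d) + 1)"
    "finite {e \<in> interior_faces M. cell_j M e = K}"
    "real (card {e \<in> interior_faces M. cell_j M e = K}) \<le> 2 ^ (CARD('d) + 1)"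
    by blast+
qed

text \<open>A set of diameter 0 has affine dimension at most 0, whereas a cell has dimension d >=
  1.\<close>

lemma diameter_cell:
  assumes "K \<in> cells M"
  shows "0 < diameter K" "diameter K \<le> diameter (region M)"
proof -
  have K: "int CARD('d) simplex K" using mesh assms by (simp add: simplicial_mesh_def)
  have bK: "bounded K" using compact_cell[OF assms] compact_imp_bounded by blast
  show "0 < diameter K"
  proof (rule ccontr)
    assume "\<not> 0 < diameter K"
    then have "diameter K = 0" using diameter_ge_0[OF bK] by linarith
    then have "K \<subseteq> {x}" if "x \<in> K" for x
      using diameter_bounded_bound[OF bK _ that] by fastforce
    then have "\<exists>x. K \<subseteq> {x}" by blast
    then have "aff_dim K \<le> 0" using aff_dim_subset by (metis aff_dim_sing)
    moreover have "aff_dim K = int CARD('d)" using K aff_dim_simplex by blast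
    ultimately show False using zero_less_card_finite[where 'a='d] by linarith
  qed
  have "K \<subseteq> closure (region M)" "bounded (region M)"
    using mesh assms by (auto simp: simplicial_mesh_def)
  then show "diameter K \<le> diameter (region M)"
    by (metis bounded_closure diameter_closure diameter_subset)
qed

text \<open>A face lies in the ball of radius \<open>diameter K\<close> about any of its own points.
  Finiteness is recorded separately because \<open>measure\<close> returns 0 on sets of infinite
  measure.\<close>

lemma
  assumes e: "e \<in> interior_faces M"
  shows emeasure_face_finite: "emeasure (face_measure M e) e < \<infinity>"
    and face_size_le: "K = cell_i M e \<or> K = cell_j M e \<Longrightarrow> face_size M e \<le>
      unit_ball_vol CARD('d) * 2 ^ CARD('d) * (1 + diameter K) * diameter K ^ (CARD('d) - 1)"
proof -
  have *: "emeasure (face_measure M e) e < \<infinity> \<and> face_size M e \<le>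
      unit_ball_vol CARD('d) * 2 ^ CARD('d) * (1 + diameter K) * diameter K ^ (CARD('d) - 1)"
    if "K = cell_i M e \<or> K = cell_j M e" for K
  proof -
    have K: "K \<in> cells M" "e \<subseteq> K" using that face_cells[OF e] by auto
    have bK: "bounded K" using compact_cell[OF K(1)] compact_imp_bounded by blast
    have "\<exists>y. e \<subseteq> cball y (diameter K)"
    proof (cases "e = {}")
      case False
      then obtain y where "y \<in> e" by blast
      then have "e \<subseteq> cball y (diameter K)"
        using diameter_bounded_bound[OF bK] K(2) by (auto simp: subset_iff)
      then show ?thesis by blast
    qed simp
    then obtain y where y: "e \<subseteq> cball y (diameter K)" ..
    have b: "e \<in> sets borel" using compact_face[OF e] by (rule borel_compact)
    show ?thesis
      unfolding face_measure_def face_size_def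
      using hyperplane_measure_le[OF face_cells(4)[OF e] b y diameter_cell(1)[OF K(1)]] by blast
  qed
  then show "emeasure (face_measure M e) e < \<infinity>" by blast
  show "face_size M e \<le>
      unit_ball_vol CARD('d) * 2 ^ CARD('d) * (1 + diameter K) * diameter K ^ (CARD('d) - 1)"
    if "K = cell_i M e \<or> K = cell_j M e"
    using *[OF that] by blast
qed

section \<open>Integrals over faces and cells\<close>

lemma face_set_integrable:
  fixes g :: "real ^ 'd \<Rightarrow> real"
  assumes e: "e \<in> interior_faces M" and g: "continuous_on UNIV g"
  shows "set_integrable (face_measure M e) e g"
proof -
  have b: "e \<in> sets (face_measure M e)"
    using compact_face[OF e] by (simp add: face_measure_def borel_compact)
  have "compact (g ` e)"
    using g compact_face[OF e] by (meson compact_continuous_image continuous_on_subset subset_UNIV)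
  then obtain C where C: "\<And>x. x \<in> e \<Longrightarrow> norm (g x) \<le> C"
    using compact_imp_bounded bounded_iff by (metis imageI)
  have "g \<in> borel_measurable (face_measure M e)"
    using borel_measurable_continuous_onI[OF g]
    by (subst measurable_cong_sets[of _ borel _ borel]) (simp_all add: face_measure_def)
  then show ?thesis
    unfolding set_integrable_def
    using b C emeasure_face_finite[OF e] by (intro integrableI_bounded_set_indicator) auto
qed

lemma face_integral_diff:
  assumes "e \<in> interior_faces M" "continuous_on UNIV f" "continuous_on UNIV g"
  shows "face_integral M e (\<lambda>x. f x - g x) = face_integral M e f - face_integral M e g"
  unfolding face_integral_def using assms by (intro set_integral_diff face_set_integrable)

lemma face_integral_mono:
  assumes "e \<in> interior_faces M" "continuous_on UNIV f" "continuous_on UNIV g" "\<And>x. x \<in> e \<Longrightarrow> f x \<le> g x"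
  shows "face_integral M e f \<le> face_integral M e g"
  unfolding face_integral_def using assms by (intro set_integral_mono face_set_integrable)

lemma face_integral_const:
  assumes e: "e \<in> interior_faces M"
  shows "face_integral M e (\<lambda>x. c) = c * face_size M e"
proof -
  have b: "e \<in> sets (face_measure M e)"
    using compact_face[OF e] by (simp add: face_measure_def borel_compact)
  then show ?thesis
    unfolding face_integral_def face_size_def
    using emeasure_face_finite[OF e] by (subst set_integral_const) auto
qed

text \<open>For faces of measure zero, where the penalty weight \<open>pen2 P / 0\<close> evaluates
  to 0 and could not absorb the traction term: that term vanishes as well.\<close>

lemma face_integral_eq_0:
  assumes e: "e \<in> interior_faces M" and 0: "face_size M e = 0"
  shows "face_integral M e f = 0"
proof -
  have b: "e \<in> sets (face_measure M e)"
    using compact_face[OF e] by (simp add: face_measure_def borel_compact)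
  have "emeasure (face_measure M e) e = 0"
    using 0 emeasure_face_finite[OF e] unfolding face_size_def
    by (simp add: emeasure_eq_ennreal_measure)
  then have "AE x in face_measure M e. x \<notin> e" using b by (intro AE_not_in) auto
  then show ?thesis
    unfolding face_integral_def set_lebesgue_integral_def
    by (intro integral_eq_zero_AE) (auto elim!: eventually_mono)
qed

lemma cell_integral_const:
  assumes "K \<in> cells M"
  shows "cell_integral K (\<lambda>x. c) = c * measure lborel K"
  unfolding cell_integral_def
  using cell_fmeasurable[OF assms] by (subst set_integral_const) (auto simp: fmeasurable_def)

lemma cell_integral_eq_const:
  assumes "K \<in> cells M" "\<And>x. g x = c"
  shows "cell_integral K g = c * measure lborel K"
proof -
  have "g = (\<lambda>x. c)" using assms(2) by (rule ext)
  then show ?thesis using cell_integral_const[OF assms(1)] by simp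
qed

end

text \<open>The Bochner integral of a nonintegrable function is 0, so the sign survives for every
  integrand.\<close>

lemma face_integral_nonneg: "(\<And>x. 0 \<le> g x) \<Longrightarrow> 0 \<le> face_integral M e g"
  unfolding face_integral_def set_lebesgue_integral_def
  by (intro Bochner_Integration.integral_nonneg) simp

lemma cell_integral_nonneg: "(\<And>x. 0 \<le> g x) \<Longrightarrow> 0 \<le> cell_integral K g"
  unfolding cell_integral_def set_lebesgue_integral_def
  by (intro Bochner_Integration.integral_nonneg) simp

lemma face_integral_mult_right: "face_integral M e (\<lambda>x. c * g x) = c * face_integral M e g"
  unfolding face_integral_def by simp

text \<open>In dimension 3 the penalty weight is \<open>1/h\<^sub>e\<close> with \<open>h\<^sub>e\<close> an area; it controls the inverse estimate
  because \<open>h\<^sub>e\<^sup>2 / |K|\<close> scales like \<open>diam(K)\<^sup>d\<^sup>-\<^sup>2\<close>, which is bounded by the diameter of the domain.\<close>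

lemma face_size_square_le:
  fixes \<Omega> :: "(real ^ 'd::finite) set"
  assumes d: "2 \<le> CARD('d)" and \<rho>: "\<rho> > 0"
  obtains C where "C > 0" and "\<And>(M :: 'd mesh) e K. simplicial_mesh M \<Longrightarrow> region M = \<Omega> \<Longrightarrow> nondegenerate \<rho> M
     \<Longrightarrow> e \<in> interior_faces M \<Longrightarrow> K = cell_i M e \<or> K = cell_j M e
     \<Longrightarrow> (face_size M e)\<^sup>2 \<le> C * measure lborel K"
proof -
  define d where "d = CARD('d)"
  \<comment> \<open>\<open>C\<close> is fixed before any mesh is given, so nothing is known about
    \<open>\<Omega>\<close> yet; the maximum keeps \<open>D\<close> positive.\<close>
  define D where "D = max 1 (diameter \<Omega>)"
  define v where "v = unit_ball_vol d"
  \<comment> \<open>The squared bound on the face size divided by the volume of an inscribed ball of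
    radius \<rho> / 2 times the diameter; the quotient keeps d - 2 powers of the diameter, bounded
    by those of \<open>D\<close>.\<close>
  define C where "C = (v * 2 ^ d * (1 + D))\<^sup>2 * D ^ (d - 2) / (v * (\<rho> / 2) ^ d)"
  have v: "v > 0" by (simp add: v_def)
  have D: "D \<ge> 1" by (simp add: D_def)
  have den: "v * (\<rho> / 2) ^ d > 0" using v \<rho> by simp
  show thesis
  proof (rule that[of C])
    show "C > 0" using v D den by (simp add: C_def)
    fix M :: "'d mesh" and e K
    assume M: "simplicial_mesh M" "region M = \<Omega>" "nondegenerate \<rho> M"
      and e: "e \<in> interior_faces M" and K: "K = cell_i M e \<or> K = cell_j M e"
    interpret valid_mesh M by standard (rule M)
    have Kc: "K \<in> cells M" using K face_cells[OF e] by auto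
    define \<delta> where "\<delta> = diameter K"
    have \<delta>: "0 < \<delta>" "\<delta> \<le> D"
      using diameter_cell[OF Kc] M(2) by (auto simp: \<delta>_def D_def)
    have "face_size M e \<le> v * 2 ^ d * (1 + \<delta>) * \<delta> ^ (d - 1)"
      using face_size_le[OF e K] by (simp add: v_def d_def \<delta>_def)
    also have "\<dots> \<le> v * 2 ^ d * (1 + D) * \<delta> ^ (d - 1)"
      using v \<delta> by (intro mult_right_mono mult_left_mono) auto
    finally have "(face_size M e)\<^sup>2 \<le> (v * 2 ^ d * (1 + D) * \<delta> ^ (d - 1))\<^sup>2"
      by (intro power_mono) (simp_all add: face_size_def)
    also have "\<dots> = (v * 2 ^ d * (1 + D))\<^sup>2 * (\<delta> ^ (d - 2) * \<delta> ^ d)"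
    proof -
      \<comment> \<open>Subtraction on naturals truncates, so this identity rests on d >= 2.\<close>
      have "(d - 1) * 2 = (d - 2) + d" using d by (simp add: d_def)
      then show ?thesis by (metis power_add power_mult power_mult_distrib)
    qed
    also have "\<dots> \<le> (v * 2 ^ d * (1 + D))\<^sup>2 * (D ^ (d - 2) * \<delta> ^ d)"
      using \<delta> by (intro mult_left_mono mult_right_mono power_mono) auto
    also have "\<dots> = C * (v * (\<rho> / 2) ^ d * \<delta> ^ d)"
      using v \<rho> unfolding C_def by simp
    also have "\<dots> \<le> C * measure lborel K"
    proof (rule mult_left_mono)
      obtain x r where r: "cball x r \<subseteq> K" "\<rho> * diameter K \<le> 2 * r"
        using M(3) Kc by (auto simp: nondegenerate_def)
      have "r \<ge> (\<rho> / 2) * \<delta>" using r by (simp add: \<delta>_def)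
      moreover have "(\<rho> / 2) * \<delta> > 0" using \<rho> \<delta> by simp
      ultimately have r0: "r \<ge> 0" and "((\<rho> / 2) * \<delta>) ^ d \<le> r ^ d" by (auto intro: power_mono)
      then have "v * (\<rho> / 2) ^ d * \<delta> ^ d \<le> v * r ^ d"
        using v by (simp add: mult.assoc flip: power_mult_distrib)
      also have "\<dots> = measure lborel (cball x r)"
        using r0 by (simp add: content_cball v_def d_def)
      also have "\<dots> \<le> measure lborel K"
        using r(1) cell_fmeasurable[OF Kc] by (intro measure_mono_fmeasurable) auto
      finally show "v * (\<rho> / 2) ^ d * \<delta> ^ d \<le> measure lborel K" .
      show "C \<ge> 0" using \<open>C > 0\<close> by simp
    qed
    finally show "(face_size M e)\<^sup>2 \<le> C * measure lborel K" .
  qed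
qed

section \<open>The interior penalty form\<close>

definition affine_field :: "(real ^ 'd \<Rightarrow> real ^ 'd::finite) \<Rightarrow> bool" where
  "affine_field u \<longleftrightarrow> (\<exists>A a. u = (\<lambda>x. A *v x + a))"

lemma jacobian_affine: "jacobian (\<lambda>x. A *v x + a) (at y) = (A :: real ^ 'd ^ 'd::finite)"
proof -
  have "((\<lambda>x. A *v x + a) has_derivative (\<lambda>x. A *v x)) (at y)"
    by (auto intro!: derivative_eq_intros bounded_linear_imp_has_derivative)
  then show ?thesis
    unfolding jacobian_def using frechet_derivative_at by (metis matrix_of_matrix_vector_mul)
qed

text \<open>The origin serves as reference point for all cells: \<open>v K\<close> is a polynomial
  on the whole space, so 0 may lie outside \<open>K\<close>.\<close>

lemma affine_field_jacobian:
  assumes "affine_field u"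
  shows "jacobian u (at x) = jacobian u (at 0)"
  using assms by (auto simp: affine_field_def jacobian_affine)

lemma affine_field_diff:
  assumes "affine_field u" "affine_field v"
  shows "affine_field (\<lambda>x. u x - v x)"
    and "jacobian (\<lambda>x. u x - v x) (at y) = jacobian u (at y) - jacobian v (at y)"
proof -
  obtain A a B b where uv: "u = (\<lambda>x. A *v x + a)" "v = (\<lambda>x. B *v x + b)"
    using assms by (auto simp: affine_field_def)
  have eq: "(\<lambda>x. u x - v x) = (\<lambda>x. (A - B) *v x + (a - b))"
    by (auto simp: uv matrix_vector_mult_diff_rdistrib)
  then show "affine_field (\<lambda>x. u x - v x)" unfolding affine_field_def by blast
  show "jacobian (\<lambda>x. u x - v x) (at y) = jacobian u (at y) - jacobian v (at y)"
    unfolding eq unfolding uv by (simp add: jacobian_affine)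
qed

lemma continuous_affine_field:
  assumes "affine_field u"
  shows "continuous_on UNIV u"
proof -
  obtain A a where "u = (\<lambda>x. A *v x + a)" using assms by (auto simp: affine_field_def)
  then show ?thesis
    by (simp only:) (intro continuous_on_add continuous_on_const linear_continuous_on
        matrix_vector_mul_bounded_linear)
qed

lemma affine_field_const:
  assumes "affine_field u"
  shows "strain u x = strain u 0" "divg u x = divg u 0" "stress P u x = stress P u 0"
  using affine_field_jacobian[OF assms, of x] by (simp_all add: strain_def divg_def stress_def)

lemma transpose_diff: "transpose (A - B) = transpose A - transpose (B :: real ^ 'n ^ 'm)"
  by (simp add: transpose_def vec_eq_iff)

lemma affine_field_diff_ops:
  assumes "affine_field u" "affine_field v"
  shows "strain (\<lambda>x. u x - v x) y = strain u y - strain v y"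
    and "divg (\<lambda>x. u x - v x) y = divg u y - divg v y"
    and "stress P (\<lambda>x. u x - v x) y = stress P u y - stress P v y"
proof -
  show s: "strain (\<lambda>x. u x - v x) y = strain u y - strain v y"
    unfolding strain_def affine_field_diff(2)[OF assms] by (simp add: transpose_diff algebra_simps)
  show d: "divg (\<lambda>x. u x - v x) y = divg u y - divg v y"
    unfolding divg_def affine_field_diff(2)[OF assms] by (simp add: trace_sub)
  show "stress P (\<lambda>x. u x - v x) y = stress P u y - stress P v y"
    unfolding stress_def s d by (simp add: algebra_simps)
qed

lemma inner_mat_1: "(A :: real ^ 'd ^ 'd::finite) \<bullet> mat 1 = trace A"
  by (simp add: inner_vec_def mat_def trace_def if_distrib cong: if_cong)

lemma trace_strain: "trace (strain u x) = divg u x"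
  by (simp add: strain_def divg_def trace_def transpose_def sum.distrib)

lemma stress_inner_strain:
  "stress P u x \<bullet> strain v x = 2 * lame_eta P * (strain u x \<bullet> strain v x) + lame_gamma P * (divg u x * divg v x)"
  by (simp add: stress_def inner_add_left inner_commute[of "mat 1"] inner_mat_1 trace_strain)

text \<open>After expansion the divergence terms on both sides agree, and the right side exceeds the
  left by a nonnegative multiple of \<open>E\<close>. The constant dominates 2 * \<eta> + d *
  \<gamma>, the largest eigenvalue of the elasticity tensor.\<close>

lemma norm_stress_square_le:
  fixes u :: "real ^ 'd \<Rightarrow> real ^ 'd::finite"
  assumes "lame_eta P > 0" "lame_gamma P > 0"
  shows "(norm (stress P u x))\<^sup>2 \<le>
    (4 * lame_eta P + CARD('d) * lame_gamma P) * (stress P u x \<bullet> strain u x)"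
proof -
  define E where "E = strain u x \<bullet> strain u x"
  have "E \<ge> 0" by (simp add: E_def)
  have I: "mat 1 \<bullet> strain u x = divg u x" "strain u x \<bullet> mat 1 = divg u x"
      "mat 1 \<bullet> (mat 1 :: real ^ 'd ^ 'd) = CARD('d)"
    by (simp_all add: inner_mat_1 trace_strain inner_commute[of "mat 1"] trace_I)
  have "(norm (stress P u x))\<^sup>2 = 4 * (lame_eta P)\<^sup>2 * E + 4 * lame_eta P * lame_gamma P * (divg u x)\<^sup>2
      + CARD('d) * (lame_gamma P)\<^sup>2 * (divg u x)\<^sup>2"
    unfolding power2_norm_eq_inner stress_def
    by (simp add: inner_add_left inner_add_right I E_def power2_eq_square algebra_simps)
  also have "\<dots> \<le> \<dots> + (4 * (lame_eta P)\<^sup>2 * E + 2 * CARD('d) * lame_gamma P * lame_eta P * E)"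
    using assms \<open>E \<ge> 0\<close> by simp
  also have "\<dots> = (4 * lame_eta P + CARD('d) * lame_gamma P) * (stress P u x \<bullet> strain u x)"
    unfolding stress_inner_strain E_def[symmetric] by (simp add: power2_eq_square algebra_simps)
  finally show ?thesis .
qed

lemma stress_inner_strain_nonneg:
  assumes "lame_eta P > 0" "lame_gamma P > 0"
  shows "0 \<le> stress P u x \<bullet> strain u x"
  unfolding stress_inner_strain using assms by simp

text \<open>The norm on \<open>real ^ 'n ^ 'm\<close> is the Frobenius norm, so Cauchy-Schwarz
  applies row by row.\<close>

lemma norm_matrix_vector_mult_le:
  "norm (A *v x) \<le> norm (A :: real ^ 'n ^ 'm) * norm x"
proof (rule power2_le_imp_le)
  have "(norm (A *v x))\<^sup>2 = (\<Sum>i\<in>UNIV. (A $ i \<bullet> x)\<^sup>2)"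
    unfolding power2_norm_eq_inner
    by (simp add: inner_vec_def matrix_vector_mult_def power2_eq_square)
  also have "\<dots> \<le> (\<Sum>i\<in>UNIV. (A $ i \<bullet> A $ i) * (norm x)\<^sup>2)"
    using Cauchy_Schwarz_ineq by (intro sum_mono) (simp add: power2_norm_eq_inner)
  also have "\<dots> = (norm A * norm x)\<^sup>2"
    by (simp add: power_mult_distrib power2_norm_eq_inner[of A] inner_vec_def[of A] sum_distrib_right)
  finally show "(norm (A *v x))\<^sup>2 \<le> (norm A * norm x)\<^sup>2" .
qed simp

definition mean_traction ::
  "params \<Rightarrow> 'd::finite mesh \<Rightarrow> 'd pw_field \<Rightarrow> (real ^ 'd) set \<Rightarrow> real ^ 'd" where
  "mean_traction P M u e = avg M e (\<lambda>K. stress P (u K) 0 *v unit_normal M e)"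

definition face_traction ::
  "params \<Rightarrow> 'd::finite mesh \<Rightarrow> 'd pw_field \<Rightarrow> 'd pw_field \<Rightarrow> (real ^ 'd) set \<Rightarrow> real" where
  "face_traction P M u v e = face_integral M e (\<lambda>x.
     avg M e (\<lambda>K. stress P (u K) x *v unit_normal M e) \<bullet> jump M e (\<lambda>K. v K x))"

definition face_jump ::
  "'d::finite mesh \<Rightarrow> 'd pw_field \<Rightarrow> 'd pw_field \<Rightarrow> (real ^ 'd) set \<Rightarrow> real" where
  "face_jump M u v e = face_integral M e (\<lambda>x. jump M e (\<lambda>K. u K x) \<bullet> jump M e (\<lambda>K. v K x))"

definition cell_elastic :: "params \<Rightarrow> 'd::finite pw_field \<Rightarrow> 'd pw_field \<Rightarrow> (real ^ 'd) set \<Rightarrow> real" where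
  "cell_elastic P u v K = cell_integral K (\<lambda>x. stress P (u K) x \<bullet> strain (v K) x)"

text \<open>The form B: the part of \<open>form_A\<close> that remains at zero pressure.\<close>

definition sip_form :: "params \<Rightarrow> 'd::finite mesh \<Rightarrow> 'd pw_field \<Rightarrow> 'd pw_field \<Rightarrow> real" where
  "sip_form P M u v = (\<Sum>K\<in>cells M. cell_elastic P u v K)
     + (\<Sum>e\<in>interior_faces M. pen2 P / face_size M e * face_jump M u v e
          - face_traction P M u v e - face_traction P M v u e)"

text \<open>The pressure tested against the discrete divergence, which includes the jumps. The same
  expression occurs in the mechanical equation and in the porosity equation, which is why the two
  Biot terms cancel.\<close>

definition coupling :: "'d::finite mesh \<Rightarrow> 'd pw_const \<Rightarrow> 'd pw_field \<Rightarrow> real" where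
  "coupling M p v = (\<Sum>K\<in>cells M. cell_integral K (\<lambda>x. p K * divg (v K) x))
     - (\<Sum>e\<in>interior_faces M. face_integral M e (\<lambda>x.
          avg M e (\<lambda>K. p K *\<^sub>R unit_normal M e) \<bullet> jump M e (\<lambda>K. v K x)))"

definition field_diff :: "'d::finite pw_field \<Rightarrow> 'd pw_field \<Rightarrow> 'd pw_field" where
  "field_diff u v = (\<lambda>K x. u K x - v K x)"

lemma form_A_eq: "form_A P M u p v = sip_form P M u v - biot_alpha P * coupling M p v"
  by (simp add: form_A_def sip_form_def coupling_def cell_elastic_def face_jump_def face_traction_def
      sum.distrib sum_subtractf inner_commute[of "jump M _ (\<lambda>K. u K _)" "avg M _ _"] algebra_simps)

lemma Vh_affine: "v \<in> Vh M \<Longrightarrow> K \<in> cells M \<Longrightarrow> affine_field (v K)"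
  by (auto simp: Vh_def affine_field_def)

lemma Vh_iff: "v \<in> Vh M \<longleftrightarrow> (\<forall>K\<in>cells M. affine_field (v K))"
  by (auto simp: Vh_def affine_field_def)

lemma field_diff_Vh: "u \<in> Vh M \<Longrightarrow> v \<in> Vh M \<Longrightarrow> field_diff u v \<in> Vh M"
  by (simp add: Vh_iff field_diff_def affine_field_diff)

lemma jump_field_diff:
  "jump M e (\<lambda>K. field_diff u v K x) = jump M e (\<lambda>K. u K x) - jump M e (\<lambda>K. v K x)"
  by (simp add: jump_def field_diff_def)

section \<open>Bilinearity, symmetry and nonnegativity of the interior penalty form\<close>

context valid_mesh
begin

lemma continuous_on_jump:
  assumes "e \<in> interior_faces M" "v \<in> Vh M"
  shows "continuous_on UNIV (\<lambda>x. jump M e (\<lambda>K. v K x))"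
  unfolding jump_def
  by (intro continuous_on_diff continuous_affine_field Vh_affine[OF assms(2)] face_cells[OF assms(1)])

lemma avg_stress_eq:
  assumes "e \<in> interior_faces M" "u \<in> Vh M"
  shows "avg M e (\<lambda>K. stress P (u K) x *v unit_normal M e) = mean_traction P M u e"
  unfolding avg_def mean_traction_def
  using affine_field_const(3)[of "u (cell_i M e)" P x] affine_field_const(3)[of "u (cell_j M e)" P x]
    Vh_affine[OF assms(2)] face_cells[OF assms(1)] by simp

lemma avg_stress_field_diff:
  assumes "e \<in> interior_faces M" "u \<in> Vh M" "v \<in> Vh M"
  shows "avg M e (\<lambda>K. stress P (field_diff u v K) x *v unit_normal M e)
    = avg M e (\<lambda>K. stress P (u K) x *v unit_normal M e) - avg M e (\<lambda>K. stress P (v K) x *v unit_normal M e)"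
  unfolding avg_def field_diff_def
  using Vh_affine[OF assms(2)] Vh_affine[OF assms(3)] face_cells[OF assms(1)]
  by (simp add: affine_field_diff_ops(3) matrix_vector_mult_diff_rdistrib algebra_simps)

lemma continuous_on_traction:
  assumes "e \<in> interior_faces M" "u \<in> Vh M" "v \<in> Vh M"
  shows "continuous_on UNIV (\<lambda>x.
     avg M e (\<lambda>K. stress P (u K) x *v unit_normal M e) \<bullet> jump M e (\<lambda>K. v K x))"
  unfolding avg_stress_eq[OF assms(1,2)]
  by (intro continuous_intros continuous_on_jump assms)

lemma face_traction_diff:
  assumes "e \<in> interior_faces M" "u \<in> Vh M" "v \<in> Vh M" "w \<in> Vh M"
  shows "face_traction P M (field_diff u v) w e = face_traction P M u w e - face_traction P M v w e"
    and "face_traction P M w (field_diff u v) e = face_traction P M w u e - face_traction P M w v e"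
  unfolding face_traction_def
  by (simp_all add: avg_stress_field_diff jump_field_diff inner_diff_left inner_diff_right assms
      face_integral_diff continuous_on_traction)

lemma face_jump_diff:
  assumes "e \<in> interior_faces M" "u \<in> Vh M" "v \<in> Vh M" "w \<in> Vh M"
  shows "face_jump M (field_diff u v) w e = face_jump M u w e - face_jump M v w e"
    and "face_jump M w (field_diff u v) e = face_jump M w u e - face_jump M w v e"
  unfolding face_jump_def jump_field_diff inner_diff_left inner_diff_right
  using assms by (auto intro!: face_integral_diff continuous_on_inner continuous_on_jump)

lemma cell_elastic_eq:
  assumes "K \<in> cells M" "u \<in> Vh M" "v \<in> Vh M"
  shows "cell_elastic P u v K = (stress P (u K) 0 \<bullet> strain (v K) 0) * measure lborel K"
proof -
  have "stress P (u K) x \<bullet> strain (v K) x = stress P (u K) 0 \<bullet> strain (v K) 0" for x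
    using affine_field_const(1)[OF Vh_affine[OF assms(3,1)], of x]
      affine_field_const(3)[OF Vh_affine[OF assms(2,1)], of P x] by simp
  then show ?thesis
    unfolding cell_elastic_def by (intro cell_integral_eq_const assms(1))
qed

lemma cell_elastic_sym:
  assumes "K \<in> cells M" "u \<in> Vh M" "v \<in> Vh M"
  shows "cell_elastic P u v K = cell_elastic P v u K"
  unfolding cell_elastic_eq[OF assms] cell_elastic_eq[OF assms(1,3,2)] stress_inner_strain
  by (simp add: inner_commute mult.commute)

lemma cell_elastic_diff:
  assumes "K \<in> cells M" "u \<in> Vh M" "v \<in> Vh M" "w \<in> Vh M"
  shows "cell_elastic P (field_diff u v) w K = cell_elastic P u w K - cell_elastic P v w K"
    and "cell_elastic P w (field_diff u v) K = cell_elastic P w u K - cell_elastic P w v K"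
  using assms affine_field_diff_ops[OF Vh_affine[OF assms(2,1)] Vh_affine[OF assms(3,1)]]
  by (simp_all add: cell_elastic_eq field_diff_Vh)
    (simp_all add: field_diff_def inner_diff_left inner_diff_right left_diff_distrib)

text \<open>Polarization of a symmetric bilinear form, carried out separately on each cell and each
  face.\<close>

lemma sip_form_diff:
  assumes "u \<in> Vh M" "v \<in> Vh M"
  shows "sip_form P M u u - sip_form P M v v
    = 2 * sip_form P M u (field_diff u v) - sip_form P M (field_diff u v) (field_diff u v)"
proof -
  let ?w = "field_diff u v"
  note w = field_diff_Vh[OF assms]
  have c: "cell_elastic P u u K - cell_elastic P v v K
      = 2 * cell_elastic P u ?w K - cell_elastic P ?w ?w K" if K: "K \<in> cells M" for K
    using cell_elastic_sym[OF K assms, of P] assms w K by (simp add: cell_elastic_diff)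
  have sym: "face_jump M u v e = face_jump M v u e" for e
    by (simp add: face_jump_def inner_commute)
  define k where "k e = pen2 P / face_size M e" for e
  define F where "F u v e = k e * face_jump M u v e
          - face_traction P M u v e - face_traction P M v u e" for u v e
  have f: "F u u e - F v v e = 2 * F u ?w e - F ?w ?w e" if e: "e \<in> interior_faces M" for e
    unfolding F_def using sym[of e] assms w e
    by (simp add: face_jump_diff face_traction_diff algebra_simps)
  have "(\<Sum>K\<in>cells M. cell_elastic P u u K - cell_elastic P v v K)
      = (\<Sum>K\<in>cells M. 2 * cell_elastic P u ?w K - cell_elastic P ?w ?w K)"
    by (intro sum.cong c) auto
  moreover have "(\<Sum>e\<in>interior_faces M. F u u e - F v v e) = (\<Sum>e\<in>interior_faces M. 2 * F u ?w e - F ?w ?w e)"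
    by (intro sum.cong f) auto
  ultimately show ?thesis
    unfolding sip_form_def k_def[symmetric] F_def[symmetric] by (simp add: sum_subtractf sum_distrib_left[symmetric])
qed

text \<open>Young's inequality with weight \<open>pen2 P / h\<close>, so that the jump part is
  exactly the penalty term. The stress part h / pen2 * |m|^2 is constant on the face, and
  integrating it contributes the second factor \<open>h\<close>.\<close>

lemma face_traction_le:
  assumes e: "e \<in> interior_faces M" and w: "w \<in> Vh M"
    and P: "lame_eta P > 0" "lame_gamma P > 0" "pen2 P > 0"
  shows "2 * face_traction P M w w e \<le> pen2 P / face_size M e * face_jump M w w e
    + (face_size M e)\<^sup>2 / pen2 P * ((4 * lame_eta P + CARD('d) * lame_gamma P) / 2 *
       (stress P (w (cell_i M e)) 0 \<bullet> strain (w (cell_i M e)) 0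
        + stress P (w (cell_j M e)) 0 \<bullet> strain (w (cell_j M e)) 0))"
proof (cases "face_size M e = 0")
  case True
  then show ?thesis
    by (simp add: face_traction_def face_jump_def face_integral_eq_0[OF e])
next
  case False
  define h where "h = face_size M e"
  have h: "h > 0" using False by (simp add: h_def face_size_def zero_less_measure_iff)
  define m where "m = mean_traction P M w e"
  define s where "s K = stress P (w K) 0" for K
  define Q where "Q = (4 * lame_eta P + CARD('d) * lame_gamma P) / 2 *
       (s (cell_i M e) \<bullet> strain (w (cell_i M e)) 0 + s (cell_j M e) \<bullet> strain (w (cell_j M e)) 0)"
  \<comment> \<open>The normal has length 1 and the square is convex, so the squared mean traction
    is at most the mean of the two squared stress norms.\<close>
  have mle: "m \<bullet> m \<le> Q"
  proof -
    let ?a = "s (cell_i M e) *v unit_normal M e" and ?b = "s (cell_j M e) *v unit_normal M e"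
    have "norm m \<le> (norm ?a + norm ?b) / 2"
      using norm_triangle_ineq[of ?a ?b] by (simp add: m_def mean_traction_def avg_def s_def)
    also have "\<dots> \<le> (norm (s (cell_i M e)) + norm (s (cell_j M e))) / 2"
      using norm_matrix_vector_mult_le[of "s (cell_i M e)" "unit_normal M e"]
        norm_matrix_vector_mult_le[of "s (cell_j M e)" "unit_normal M e"] face_cells(4)[OF e] by simp
    finally have "(norm m)\<^sup>2 \<le> ((norm (s (cell_i M e)) + norm (s (cell_j M e))) / 2)\<^sup>2"
      by (intro power_mono) auto
    also have "\<dots> \<le> ((norm (s (cell_i M e)))\<^sup>2 + (norm (s (cell_j M e)))\<^sup>2) / 2"
      using sum_squares_bound[of "norm (s (cell_i M e))" "norm (s (cell_j M e))"]
      by (simp add: power2_eq_square field_simps)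
    also have "\<dots> \<le> Q"
      using norm_stress_square_le[OF P(1,2), of "w (cell_i M e)" 0] norm_stress_square_le[OF P(1,2), of "w (cell_j M e)" 0]
      unfolding Q_def s_def by (simp add: distrib_left)
    finally show ?thesis by (simp add: power2_norm_eq_inner)
  qed
  let ?j = "\<lambda>x. jump M e (\<lambda>K. w K x)"
  have young: "2 * (m \<bullet> y) \<le> h / pen2 P * (m \<bullet> m) + pen2 P / h * (y \<bullet> y)" for y
  proof -
    define t where "t = pen2 P / h"
    have t: "t > 0" using h P by (simp add: t_def)
    have "0 \<le> (m - t *\<^sub>R y) \<bullet> (m - t *\<^sub>R y) / t" using t by simp
    also have "\<dots> = 1 / t * (m \<bullet> m) - 2 * (m \<bullet> y) + t * (y \<bullet> y)"
      using t by (simp add: inner_diff_left inner_diff_right inner_commute[of y m] field_simps power2_eq_square)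
    finally show ?thesis by (simp add: t_def)
  qed
  have cj: "continuous_on UNIV (\<lambda>x. ?j x \<bullet> ?j x)"
    using e w by (intro continuous_on_inner continuous_on_jump)
  have "2 * face_traction P M w w e = face_integral M e (\<lambda>x. 2 * (m \<bullet> ?j x))"
    unfolding face_traction_def avg_stress_eq[OF e w] m_def[symmetric]
    by (simp add: face_integral_mult_right)
  \<comment> \<open>The constant is subtracted with a double sign so that the bound splits by
    \<open>face_integral_diff\<close>.\<close>
  also have "\<dots> \<le> face_integral M e (\<lambda>x. pen2 P / h * (?j x \<bullet> ?j x) - - (h / pen2 P * (m \<bullet> m)))"
    using young cj e w
    by (intro face_integral_mono continuous_intros continuous_on_jump) (auto simp: add.commute)
  also have "\<dots> = pen2 P / h * face_jump M w w e + h / pen2 P * (m \<bullet> m) * h"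
    unfolding face_integral_diff[OF e continuous_on_mult_left[OF cj] continuous_on_const]
      face_integral_mult_right face_integral_const[OF e] face_jump_def h_def by simp
  also have "\<dots> \<le> pen2 P / h * face_jump M w w e + h\<^sup>2 / pen2 P * Q"
    using mult_left_mono[OF mle, of "h\<^sup>2 / pen2 P"] P by (simp add: power2_eq_square mult_ac)
  finally show ?thesis unfolding h_def Q_def s_def .
qed

text \<open>Faces are grouped by their cell. A cell occurs at most 2^(d + 1) times as
  \<open>cell_i\<close> and as often as \<open>cell_j\<close>, which doubles the constant.\<close>

lemma sum_faces_le:
  fixes s :: "(real ^ 'd) set \<Rightarrow> real"
  assumes "\<And>K. K \<in> cells M \<Longrightarrow> 0 \<le> s K"
  shows "(\<Sum>e\<in>interior_faces M. s (cell_i M e) + s (cell_j M e)) \<le> 2 ^ (CARD('d) + 2) * (\<Sum>K\<in>cells M. s K)"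
proof -
  have *: "(\<Sum>e\<in>interior_faces M. s (g e)) \<le> 2 ^ (CARD('d) + 1) * (\<Sum>K\<in>cells M. s K)"
    if g: "g ` interior_faces M \<subseteq> cells M"
      "\<And>K. K \<in> cells M \<Longrightarrow> real (card {e \<in> interior_faces M. g e = K}) \<le> 2 ^ (CARD('d) + 1)" for g
  proof -
    have "(\<Sum>e\<in>interior_faces M. s (g e)) = (\<Sum>K\<in>cells M. \<Sum>e | e \<in> interior_faces M \<and> g e = K. s (g e))"
      by (rule sum.group[OF finite_interior_faces finite_cells g(1), symmetric])
    also have "\<dots> = (\<Sum>K\<in>cells M. real (card {e \<in> interior_faces M. g e = K}) * s K)"
      by (intro sum.cong) auto
    also have "\<dots> \<le> (\<Sum>K\<in>cells M. 2 ^ (CARD('d) + 1) * s K)"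
      using g(2) assms by (intro sum_mono mult_right_mono)
    finally show ?thesis by (simp add: sum_distrib_left)
  qed
  show ?thesis
    using *[of "cell_i M"] *[of "cell_j M"] face_cells card_faces_le
    by (simp add: sum.distrib image_subset_iff)
qed

text \<open>On each face the traction left over after the penalty is bounded by the elastic energies
  of the two adjacent cells. Summed over the faces this is at most C * L * 2^(d + 1) / pen2 times
  the total elastic energy, and the penalty threshold makes that factor at most 1.\<close>

lemma sip_form_nonneg:
  assumes w: "w \<in> Vh M" and P: "lame_eta P > 0" "lame_gamma P > 0" "pen2 P > 0"
    and C: "C \<ge> 0" "\<And>e K. e \<in> interior_faces M \<Longrightarrow> K = cell_i M e \<or> K = cell_j M e
       \<Longrightarrow> (face_size M e)\<^sup>2 \<le> C * measure lborel K"
    and pen: "pen2 P \<ge> C * (4 * lame_eta P + CARD('d) * lame_gamma P) * 2 ^ (CARD('d) + 1)"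
  shows "0 \<le> sip_form P M w w"
proof -
  define L where "L = 4 * lame_eta P + CARD('d) * lame_gamma P"
  have L: "L > 0" using P by (simp add: L_def add_pos_nonneg)
  define q where "q K = stress P (w K) 0 \<bullet> strain (w K) 0" for K
  define s where "s K = q K * measure lborel K" for K
  have q: "q K \<ge> 0" for K unfolding q_def by (rule stress_inner_strain_nonneg[OF P(1,2)])
  then have s: "s K \<ge> 0" for K by (simp add: s_def)
  define T where "T e = pen2 P / face_size M e * face_jump M w w e
          - face_traction P M w w e - face_traction P M w w e" for e
  have T: "- T e \<le> C * L / (2 * pen2 P) * (s (cell_i M e) + s (cell_j M e))" if e: "e \<in> interior_faces M" for e
  proof -
    have sq: "(face_size M e)\<^sup>2 * q K \<le> C * s K" if "K = cell_i M e \<or> K = cell_j M e" for K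
      using mult_right_mono[OF C(2)[OF e that] q[of K]] by (simp add: s_def mult_ac)
    have "- T e \<le> (face_size M e)\<^sup>2 / pen2 P * (L / 2 * (q (cell_i M e) + q (cell_j M e)))"
      using face_traction_le[OF e w P] by (simp add: T_def L_def q_def)
    also have "\<dots> = L / (2 * pen2 P) * ((face_size M e)\<^sup>2 * q (cell_i M e) + (face_size M e)\<^sup>2 * q (cell_j M e))"
      by (simp add: field_simps)
    also have "\<dots> \<le> L / (2 * pen2 P) * (C * s (cell_i M e) + C * s (cell_j M e))"
      using sq L P by (intro mult_left_mono add_mono) auto
    finally show ?thesis by (simp add: field_simps)
  qed
  have "- (\<Sum>e\<in>interior_faces M. T e) \<le> (\<Sum>e\<in>interior_faces M. C * L / (2 * pen2 P) * (s (cell_i M e) + s (cell_j M e)))"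
    unfolding sum_negf[symmetric] using T by (intro sum_mono)
  also have "\<dots> \<le> C * L / (2 * pen2 P) * (2 ^ (CARD('d) + 2) * (\<Sum>K\<in>cells M. s K))"
    unfolding sum_distrib_left[symmetric]
    using sum_faces_le[of s] s C(1) L P by (intro mult_left_mono) auto
  also have "\<dots> = C * L * 2 ^ (CARD('d) + 1) / pen2 P * (\<Sum>K\<in>cells M. s K)"
    by simp
  also have "\<dots> \<le> 1 * (\<Sum>K\<in>cells M. s K)"
    using pen P s by (intro mult_right_mono sum_nonneg) (auto simp: L_def)
  also have "\<dots> = (\<Sum>K\<in>cells M. cell_elastic P w w K)"
    using w by (simp add: s_def q_def cell_elastic_eq)
  finally show ?thesis unfolding sip_form_def T_def by simp
qed

text \<open>On the diagonal the two traction terms of \<open>sip_form\<close> coincide, so half of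
  the form carries the traction with coefficient 1, as in the energy.\<close>

lemma total_energy_eq:
  assumes "us S \<in> Vh M"
  shows "total_energy P M S
    = (\<Sum>K\<in>cells M. (por S K * free_energy P (conc S K) + 1 / (2 * biot_N P) * (pres S K)\<^sup>2) * measure lborel K)
      + 1 / 2 * sip_form P M (us S) (us S)"
proof -
  have "cell_integral K (\<lambda>x. por S K * free_energy P (conc S K)
        + 1 / 2 * (stress P (us S K) x \<bullet> strain (us S K) x) + 1 / (2 * biot_N P) * \<bar>pres S K\<bar>\<^sup>2)
      = (por S K * free_energy P (conc S K) + 1 / (2 * biot_N P) * (pres S K)\<^sup>2) * measure lborel K
        + 1 / 2 * cell_elastic P (us S) (us S) K" if K: "K \<in> cells M" for K
  proof -
    have "stress P (us S K) x \<bullet> strain (us S K) x = stress P (us S K) 0 \<bullet> strain (us S K) 0" for x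
      using affine_field_const(1)[OF Vh_affine[OF assms K], of x]
        affine_field_const(3)[OF Vh_affine[OF assms K], of P x] by simp
    then have "cell_integral K (\<lambda>x. por S K * free_energy P (conc S K)
        + 1 / 2 * (stress P (us S K) x \<bullet> strain (us S K) x) + 1 / (2 * biot_N P) * \<bar>pres S K\<bar>\<^sup>2)
      = (por S K * free_energy P (conc S K)
        + 1 / 2 * (stress P (us S K) 0 \<bullet> strain (us S K) 0) + 1 / (2 * biot_N P) * \<bar>pres S K\<bar>\<^sup>2)
        * measure lborel K"
      by (intro cell_integral_eq_const K) simp
    then show ?thesis
      unfolding cell_elastic_eq[OF K assms assms] by (simp add: algebra_simps)
  qed
  then have cells: "(\<Sum>K\<in>cells M. cell_integral K (\<lambda>x. por S K * free_energy P (conc S K)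
        + 1 / 2 * (stress P (us S K) x \<bullet> strain (us S K) x) + 1 / (2 * biot_N P) * \<bar>pres S K\<bar>\<^sup>2))
      = (\<Sum>K\<in>cells M. (por S K * free_energy P (conc S K) + 1 / (2 * biot_N P) * (pres S K)\<^sup>2) * measure lborel K)
        + 1 / 2 * (\<Sum>K\<in>cells M. cell_elastic P (us S) (us S) K)"
    by (simp only: sum.distrib sum_distrib_left cong: sum.cong)
  have "(\<Sum>e\<in>interior_faces M. pen2 P / (2 * face_size M e) * face_jump M (us S) (us S) e)
      - (\<Sum>e\<in>interior_faces M. face_traction P M (us S) (us S) e)
      = 1 / 2 * (\<Sum>e\<in>interior_faces M. pen2 P / face_size M e * face_jump M (us S) (us S) e
          - face_traction P M (us S) (us S) e - face_traction P M (us S) (us S) e)"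
    unfolding sum_subtractf[symmetric] sum_distrib_left by (intro sum.cong) auto
  then show ?thesis
    unfolding total_energy_def sip_form_def cells face_jump_def[symmetric] face_traction_def[symmetric]
    by (simp only: distrib_left add_diff_eq[symmetric] add.assoc)
qed

end

section \<open>Energy dissipation\<close>

lemma cell_integral_mult_right: "cell_integral K (\<lambda>x. c * g x) = c * cell_integral K g"
  unfolding cell_integral_def by simp

lemma mobility_nonneg:
  assumes "admissible_params P" "0 < \<phi>" "\<phi> < 1"
  shows "0 \<le> mobility P \<phi>"
  using assms by (simp add: admissible_params_def mobility_def permeability_def)

lemma (in valid_mesh) stab_theta_ge:
  assumes "K \<in> cells M"
  shows "(1 - covol P * conc S0 K)\<^sup>2 / (chi1 P \<delta>\<^sub>1 S0 K * (1 - chi1 P \<delta>\<^sub>1 S0 K * covol P * conc S0 K)\<^sup>2)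
      \<le> stab_theta P M \<delta>\<^sub>1 \<delta>\<^sub>2 S0"
    and "(1 - covol P * conc S0 K)\<^sup>2 / (chi2 P \<delta>\<^sub>2 S0 K * (1 - chi2 P \<delta>\<^sub>2 S0 K * covol P * conc S0 K)\<^sup>2)
      \<le> stab_theta P M \<delta>\<^sub>1 \<delta>\<^sub>2 S0"
  unfolding stab_theta_def using assms finite_cells by (intro Max_ge; auto)+

text \<open>The interval of admissible concentrations stays away from 0 and from the pole at 1 /
  \<beta>. For the upper end, with x = \<beta> c, one has 1 - \<chi> x = (1 - x) * (1 - \<delta> x
  (1 - x)) > 0, where \<chi> is \<open>chi2\<close> and \<delta> is
  \<open>\<delta>\<^sub>2\<close>.\<close>

lemma (in valid_mesh) free_energy_conc_le:
  assumes P: "admissible_params P" and K: "K \<in> cells M"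
    and c0: "0 < conc S0 K" "covol P * conc S0 K < 1"
    and \<delta>: "0 < \<delta>\<^sub>1" "\<delta>\<^sub>1 < 1" "0 < \<delta>\<^sub>2" "\<delta>\<^sub>2 < 1"
    and c1: "chi1 P \<delta>\<^sub>1 S0 K * conc S0 K \<le> conc S1 K" "conc S1 K \<le> chi2 P \<delta>\<^sub>2 S0 K * conc S0 K"
  shows "free_energy P (conc S1 K) - free_energy P (conc S0 K)
    \<le> stab_mu P (stab_theta P M \<delta>\<^sub>1 \<delta>\<^sub>2 S0) S0 S1 K * (conc S1 K - conc S0 K)"
  unfolding stab_mu_def
proof (rule free_energy_increment_le[OF P c0 _ _ _ _ c1 stab_theta_ge[OF K]])
  define x where "x = covol P * conc S0 K"
  have x: "0 < x" "x < 1" using P c0 by (auto simp: x_def admissible_params_def)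
  then have sq: "0 < (1 - x)\<^sup>2" "(1 - x)\<^sup>2 < 1"
    by (auto simp: power_less_one_iff abs_square_less_1)
  have "\<delta>\<^sub>1 * (1 - x)\<^sup>2 < 1" using \<delta> sq by (smt (verit) mult_le_one mult_less_cancel_right2)
  then show "0 < chi1 P \<delta>\<^sub>1 S0 K" by (simp add: chi1_def x_def)
  show "chi1 P \<delta>\<^sub>1 S0 K \<le> 1" "1 \<le> chi2 P \<delta>\<^sub>2 S0 K"
    using \<delta> by (auto simp: chi1_def chi2_def)
  have "\<delta>\<^sub>2 * (x * (1 - x)) < 1"
  proof -
    have "x * (1 - x) < 1 * 1" using x by (intro mult_strict_mono') auto
    then have "\<delta>\<^sub>2 * (x * (1 - x)) < 1 * 1" using \<delta> x by (intro mult_strict_mono') auto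
    then show ?thesis by simp
  qed
  then have "\<delta>\<^sub>2 * (x * (1 - x)) * (1 - x) < 1 * (1 - x)" using x by (intro mult_strict_right_mono) auto
  then have "(1 + \<delta>\<^sub>2 * (1 - x)\<^sup>2) * x < 1" by (simp add: power2_eq_square algebra_simps)
  then show "chi2 P \<delta>\<^sub>2 S0 K * (covol P * conc S0 K) < 1" by (simp add: chi2_def x_def)
qed

section \<open>The energy balance of one time step\<close>

context valid_mesh
begin

lemma coupling_Dt:
  assumes "u \<in> Vh M" "v \<in> Vh M"
  shows "(\<Sum>K\<in>cells M. cell_integral K (\<lambda>x. Dt \<tau> (divg (u K) x) (divg (v K) x) * p K))
      - (\<Sum>e\<in>interior_faces M. face_integral M e (\<lambda>x.
           avg M e (\<lambda>K. p K *\<^sub>R unit_normal M e) \<bullet> jump M e (\<lambda>K. Dt \<tau> (u K x) (v K x))))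
      = 1 / \<tau> * coupling M p (field_diff u v)"
proof -
  have "cell_integral K (\<lambda>x. Dt \<tau> (divg (u K) x) (divg (v K) x) * p K)
      = 1 / \<tau> * cell_integral K (\<lambda>x. p K * divg (field_diff u v K) x)" if K: "K \<in> cells M" for K
    unfolding cell_integral_mult_right[symmetric] field_diff_def
      affine_field_diff_ops(2)[OF Vh_affine[OF assms(1) K] Vh_affine[OF assms(2) K]]
    by (simp add: Dt_def mult_ac)
  moreover have "face_integral M e (\<lambda>x. a \<bullet> jump M e (\<lambda>K. Dt \<tau> (u K x) (v K x)))
      = 1 / \<tau> * face_integral M e (\<lambda>x. a \<bullet> jump M e (\<lambda>K. field_diff u v K x))" for e a
    unfolding face_integral_mult_right[symmetric]
    by (simp add: jump_def Dt_def field_diff_def flip: scaleR_diff_right)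
  ultimately show ?thesis
    unfolding coupling_def by (simp add: right_diff_distrib sum_distrib_left)
qed

text \<open>The two analytic inputs, the increment estimate for f and nonnegativity of the penalty
  form, enter as the assumptions \<open>f\<close> and \<open>sip\<close>; what remains is testing
  the scheme and adding up.\<close>

lemma discrete_energy_le:
  assumes P: "admissible_params P" and \<tau>: "\<tau> > 0"
    and u0: "us S0 \<in> Vh M"
    and por0: "\<And>K. K \<in> cells M \<Longrightarrow> 0 < por S0 K \<and> por S0 K < 1"
    and por1: "\<And>K. K \<in> cells M \<Longrightarrow> 0 < por S1 K"
    and scheme: "discrete_scheme P M \<tau> \<theta> S0 S1"
    and f: "\<And>K. K \<in> cells M \<Longrightarrow> free_energy P (conc S1 K) - free_energy P (conc S0 K)
       \<le> stab_mu P \<theta> S0 S1 K * (conc S1 K - conc S0 K)"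
    and sip: "\<And>w. w \<in> Vh M \<Longrightarrow> 0 \<le> sip_form P M w w"
  shows "total_energy P M S1 \<le> total_energy P M S0"
proof -
  define \<mu> where "\<mu> = stab_mu P \<theta> S0 S1"
  define vol where "vol K = measure lborel K" for K :: "(real ^ 'd) set"
  define w where "w = field_diff (us S1) (us S0)"
  note defs = scheme[unfolded discrete_scheme_def, folded \<mu>_def]
  note pressure = defs[THEN conjunct2, THEN conjunct2, THEN conjunct2, THEN conjunct2, THEN conjunct2,
      THEN conjunct1]
  have u1: "us S1 \<in> Vh M" and uf1: "uf S1 \<in> Uh0 M" using defs by auto
  have w: "w \<in> Vh M" unfolding w_def by (rule field_diff_Vh[OF u1 u0])
  have N: "biot_N P > 0" "pen1 P > 0" using P by (auto simp: admissible_params_def)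
  have vol0: "vol K \<ge> 0" for K by (simp add: vol_def)

  have "form_A P M (us S1) (pres S1) w = 0" using defs w by blast
  then have mech: "sip_form P M (us S1) w = biot_alpha P * coupling M (pres S1) w"
    by (simp add: form_A_eq)

  \<comment> \<open>\<open>T\<close>, \<open>X\<close> and \<open>Y\<close> are the increments of
    mass, porosity and pressure tested with \<mu>, p and p at the new level, freed of the factor 1 /
    \<tau>.\<close>
  define T where "T = (\<Sum>K\<in>cells M. (por S1 K * conc S1 K - por S0 K * conc S0 K) * \<mu> K * vol K)"
  define X where "X = (\<Sum>K\<in>cells M. (por S1 K - por S0 K) * pres S1 K * vol K)"
  define Y where "Y = (\<Sum>K\<in>cells M. (pres S1 K - pres S0 K) * pres S1 K * vol K)"

  have "T \<le> 0"
  proof -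
    define J where "J = (\<Sum>e\<in>interior_faces M. face_integral M e (\<lambda>x.
             upwind_c M S0 e x * flux M e (uf S1) x * jump M e \<mu>))"
    define G where "G = (\<Sum>e\<in>interior_faces M. pen1 P / face_size M e * face_integral M e (\<lambda>x.
             jump M e \<mu> * jump M e \<mu>))"
    have "(\<Sum>K\<in>cells M. cell_integral K (\<lambda>x. Dt \<tau> (por S1 K * conc S1 K) (por S0 K * conc S0 K) * \<mu> K))
        + J + G = 0"
      using defs unfolding J_def G_def by blast
    moreover have "(\<Sum>K\<in>cells M. cell_integral K (\<lambda>x. Dt \<tau> (por S1 K * conc S1 K) (por S0 K * conc S0 K) * \<mu> K))
        = T / \<tau>"
      unfolding T_def sum_divide_distrib vol_def
      by (intro sum.cong refl) (simp add: cell_integral_const Dt_def)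
    moreover have "G \<ge> 0"
      unfolding G_def using N
      by (intro sum_nonneg mult_nonneg_nonneg[OF _ face_integral_nonneg]) (auto simp: face_size_def)
    \<comment> \<open>The transport term carries the same upwind value as the velocity equation.
      Testing the latter with the new velocity turns \<open>J\<close> into a weighted L^2 norm,
      whichever side the upwinding selects.\<close>
    moreover have "J \<ge> 0"
    proof -
      have "J = (\<Sum>e\<in>interior_faces M. face_integral M e (\<lambda>x.
             jump M e \<mu> * (upwind_c M S0 e x * flux M e (uf S1) x)))"
        unfolding J_def by (simp add: mult_ac)
      also have "\<dots> = (\<Sum>K\<in>cells M. cell_integral K (\<lambda>x.
          (inverse (mobility P (por S0 K)) *\<^sub>R uf S1 K x) \<bullet> uf S1 K x))"
        using defs uf1 by simp
      also have "\<dots> \<ge> 0"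
        using mobility_nonneg[OF P] por0 by (intro sum_nonneg cell_integral_nonneg) simp
      finally show ?thesis .
    qed
    ultimately have "T / \<tau> \<le> 0" by linarith
    then show ?thesis using \<tau> by (simp add: divide_le_0_iff)
  qed

  have X: "X = (\<Sum>K\<in>cells M. (por S1 K - por S0 K) * (conc S0 K * \<mu> K - free_energy P (conc S0 K)) * vol K)"
  proof -
    have "(\<Sum>K\<in>cells M. cell_integral K (\<lambda>x. pres S1 K * (por S1 K - por S0 K)))
        = (\<Sum>K\<in>cells M. cell_integral K (\<lambda>x.
             (conc S0 K * \<mu> K - free_energy P (conc S0 K)) * (por S1 K - por S0 K)))"
      using pressure[THEN spec, of "\<lambda>K. por S1 K - por S0 K"] .
    moreover have "(\<Sum>K\<in>cells M. cell_integral K (\<lambda>x. a K * (por S1 K - por S0 K)))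
      = (\<Sum>K\<in>cells M. (por S1 K - por S0 K) * a K * vol K)" for a
      by (intro sum.cong refl) (simp add: cell_integral_const vol_def)
    ultimately show ?thesis unfolding X_def by simp
  qed

  \<comment> \<open>The porosity equation tested with the new pressure; its coupling term is then
    replaced by means of \<open>mech\<close>.\<close>
  have XY: "X = Y / biot_N P + sip_form P M (us S1) w"
  proof -
    let ?C = "\<Sum>K\<in>cells M. cell_integral K (\<lambda>x. Dt \<tau> (divg (us S1 K) x) (divg (us S0 K) x) * pres S1 K)"
    let ?F = "\<Sum>e\<in>interior_faces M. face_integral M e (\<lambda>x.
           avg M e (\<lambda>K. pres S1 K *\<^sub>R unit_normal M e) \<bullet> jump M e (\<lambda>K. Dt \<tau> (us S1 K x) (us S0 K x)))"
    have Dt: "(\<Sum>K\<in>cells M. cell_integral K (\<lambda>x. Dt \<tau> (a K) (b K) * pres S1 K))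
      = (\<Sum>K\<in>cells M. (a K - b K) * pres S1 K * vol K) / \<tau>" for a b
      unfolding sum_divide_distrib
      by (intro sum.cong refl) (simp add: cell_integral_const vol_def Dt_def)
    have "(\<Sum>K\<in>cells M. cell_integral K (\<lambda>x. Dt \<tau> (por S1 K) (por S0 K) * pres S1 K))
        = 1 / biot_N P * (\<Sum>K\<in>cells M. cell_integral K (\<lambda>x. Dt \<tau> (pres S1 K) (pres S0 K) * pres S1 K))
          + biot_alpha P * ?C - biot_alpha P * ?F"
      using defs by blast
    then have "X / \<tau> = 1 / biot_N P * (Y / \<tau>) + biot_alpha P * (?C - ?F)"
      unfolding Dt X_def Y_def by (simp add: right_diff_distrib)
    also have "\<dots> = 1 / biot_N P * (Y / \<tau>) + biot_alpha P * (1 / \<tau> * coupling M (pres S1) w)"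
      using coupling_Dt[OF u1 u0, of \<tau> "pres S1"] by (simp add: w_def)
    also have "\<dots> = (Y / biot_N P + sip_form P M (us S1) w) / \<tau>"
      by (simp add: mech add_divide_distrib)
    finally show ?thesis using \<tau> by simp
  qed

  define E where "E S K = (por S K * free_energy P (conc S K) + 1 / (2 * biot_N P) * (pres S K)\<^sup>2) * vol K"
    for S :: "'d state" and K
  \<comment> \<open>The first two terms on the right equal \<phi>1 * \<mu> * (c1 - c0) + (\<phi>1 -
    \<phi>0) * f(c0), while the increment of \<phi> f is \<phi>1 * (f(c1) - f(c0)) + (\<phi>1 -
    \<phi>0) * f(c0). In the pressure part the square (p1 - p0)^2 is dropped.\<close>
  have cell: "E S1 K - E S0 K \<le> (por S1 K * conc S1 K - por S0 K * conc S0 K) * \<mu> K * vol K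
      - (por S1 K - por S0 K) * (conc S0 K * \<mu> K - free_energy P (conc S0 K)) * vol K
      + (pres S1 K - pres S0 K) * pres S1 K * vol K / biot_N P" if K: "K \<in> cells M" for K
  proof -
    have "por S1 K * (free_energy P (conc S1 K) - free_energy P (conc S0 K))
        \<le> por S1 K * (\<mu> K * (conc S1 K - conc S0 K))"
      using f[OF K] por1[OF K] by (intro mult_left_mono) (auto simp: \<mu>_def)
    then have "por S1 K * free_energy P (conc S1 K) - por S0 K * free_energy P (conc S0 K)
        \<le> (por S1 K * conc S1 K - por S0 K * conc S0 K) * \<mu> K
          - (por S1 K - por S0 K) * (conc S0 K * \<mu> K - free_energy P (conc S0 K))"
      by (simp add: algebra_simps)
    moreover have "1 / (2 * biot_N P) * (pres S1 K)\<^sup>2 - 1 / (2 * biot_N P) * (pres S0 K)\<^sup>2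
        \<le> (pres S1 K - pres S0 K) * pres S1 K / biot_N P"
    proof -
      have "(pres S1 K)\<^sup>2 - (pres S0 K)\<^sup>2 \<le> 2 * ((pres S1 K - pres S0 K) * pres S1 K)"
        using zero_le_power2[of "pres S1 K - pres S0 K"] by (simp add: power2_eq_square algebra_simps)
      then have "((pres S1 K)\<^sup>2 - (pres S0 K)\<^sup>2) / (2 * biot_N P)
          \<le> 2 * ((pres S1 K - pres S0 K) * pres S1 K) / (2 * biot_N P)"
        using N by (intro divide_right_mono) auto
      then show ?thesis by (simp add: diff_divide_distrib)
    qed
    ultimately have "por S1 K * free_energy P (conc S1 K) + 1 / (2 * biot_N P) * (pres S1 K)\<^sup>2
        - (por S0 K * free_energy P (conc S0 K) + 1 / (2 * biot_N P) * (pres S0 K)\<^sup>2)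
        \<le> (por S1 K * conc S1 K - por S0 K * conc S0 K) * \<mu> K
          - (por S1 K - por S0 K) * (conc S0 K * \<mu> K - free_energy P (conc S0 K))
          + (pres S1 K - pres S0 K) * pres S1 K / biot_N P"
      by linarith
    from mult_right_mono[OF this vol0[of K]] show ?thesis
      unfolding E_def by (simp add: left_diff_distrib distrib_right)
  qed
  have "(\<Sum>K\<in>cells M. E S1 K) - (\<Sum>K\<in>cells M. E S0 K) \<le> T - X + Y / biot_N P"
    unfolding X T_def Y_def sum_divide_distrib sum_subtractf[symmetric] sum.distrib[symmetric]
    using cell by (intro sum_mono)
  moreover have "sip_form P M (us S1) (us S1) - sip_form P M (us S0) (us S0) \<le> 2 * sip_form P M (us S1) w"
    using sip_form_diff[OF u1 u0, of P] sip[OF w] by (simp add: w_def)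
  \<comment> \<open>Half the increment of the penalty form is at most
    \<open>sip_form P M (us S1) w\<close> = X - Y / N, so everything cancels except
    \<open>T\<close>.\<close>
  ultimately show ?thesis
    unfolding total_energy_eq[OF u1] total_energy_eq[OF u0] E_def[unfolded vol_def, symmetric]
    using \<open>T \<le> 0\<close> XY by simp
qed

end

theorem theorem5p3:
  fixes \<Omega> :: "(real ^ 'd) set" and \<eta> \<gamma> \<rho> \<rho>' :: real
  assumes dim: "CARD('d) = 2 \<or> CARD('d) = 3"
    and const: "\<eta> > 0" "\<gamma> > 0" "\<rho> > 0" "\<rho>' > 0"
  shows "\<exists>\<zeta>\<^sub>0 > 0. \<forall>(P :: params) (M :: 'd mesh) (S0 :: 'd state) (S1 :: 'd state)
           (\<tau> :: real) (\<epsilon> :: real) (r :: real) (\<delta>\<^sub>1 :: real) (\<delta>\<^sub>2 :: real).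
      admissible_params P \<and> lame_eta P = \<eta> \<and> lame_gamma P = \<gamma> \<and> pen2 P \<ge> \<zeta>\<^sub>0 \<and>
      simplicial_mesh M \<and> region M = \<Omega> \<and> nondegenerate \<rho> M \<and> quasi_uniform \<rho>' M \<and>
      \<tau> > 0 \<and>
      us S0 \<in> Vh M \<and> uf S0 \<in> Uh0 M \<and>
      (\<forall>K\<in>cells M. 0 < por S0 K \<and> por S0 K < 1) \<and>
      0 < \<epsilon> \<and> r / covol P < 1 / covol P \<and>
      (\<forall>K\<in>cells M. \<epsilon> \<le> conc S0 K \<and> conc S0 K \<le> r / covol P) \<and>
      0 < \<delta>\<^sub>1 \<and> \<delta>\<^sub>1 < 1 \<and> 0 < \<delta>\<^sub>2 \<and> \<delta>\<^sub>2 < 1 \<and>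
      discrete_scheme P M \<tau> (stab_theta P M \<delta>\<^sub>1 \<delta>\<^sub>2 S0) S0 S1 \<and>
      (\<forall>K\<in>cells M. 0 < por S1 K \<and> por S1 K < 1) \<and>
      (\<forall>K\<in>cells M. chi1 P \<delta>\<^sub>1 S0 K * conc S0 K \<le> conc S1 K \<and> conc S1 K \<le> chi2 P \<delta>\<^sub>2 S0 K * conc S0 K)
      \<longrightarrow> (total_energy P M S1 - total_energy P M S0) / \<tau> \<le> 0"
proof -
  have "2 \<le> CARD('d)" using dim by auto
  from face_size_square_le[OF this const(3), where \<Omega> = \<Omega>] obtain C where C: "C > 0"
    "\<And>(M :: 'd mesh) e K. simplicial_mesh M \<Longrightarrow> region M = \<Omega> \<Longrightarrow> nondegenerate \<rho> M
     \<Longrightarrow> e \<in> interior_faces M \<Longrightarrow> K = cell_i M e \<or> K = cell_j M e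
     \<Longrightarrow> (face_size M e)\<^sup>2 \<le> C * measure lborel K"
    by blast
  \<comment> \<open>The threshold of \<open>sip_form_nonneg\<close>. It depends only on the domain,
    the dimension, the shape regularity and the Lame constants, hence can be chosen before the mesh,
    the time step and the data.\<close>
  let ?\<zeta> = "C * (4 * \<eta> + CARD('d) * \<gamma>) * 2 ^ (CARD('d) + 1)"
  show ?thesis
  proof (intro exI[of _ ?\<zeta>] conjI allI impI, goal_cases)
    case 1
    show ?case using C(1) const by (simp add: add_pos_nonneg)
  next
    case (2 P M S0 S1 \<tau> \<epsilon> r \<delta>\<^sub>1 \<delta>\<^sub>2)
    then have P: "admissible_params P" and lame: "lame_eta P = \<eta>" "lame_gamma P = \<gamma>"
      and M: "simplicial_mesh M" "region M = \<Omega>" "nondegenerate \<rho> M" by auto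
    interpret valid_mesh M by standard (rule M)
    have \<tau>: "\<tau> > 0" using 2 by blast
    have "total_energy P M S1 \<le> total_energy P M S0"
    proof (rule discrete_energy_le[OF P \<tau>])
      show "discrete_scheme P M \<tau> (stab_theta P M \<delta>\<^sub>1 \<delta>\<^sub>2 S0) S0 S1" using 2 by blast
      show "us S0 \<in> Vh M" using 2 by blast
      show "0 < por S0 K \<and> por S0 K < 1" "0 < por S1 K" if "K \<in> cells M" for K
        using 2 that by blast+
      show "0 \<le> sip_form P M w w" if "w \<in> Vh M" for w
        using that const P C(1) C(2)[OF M] 2
        by (intro sip_form_nonneg[where C = C]) (auto simp: lame admissible_params_def)
      fix K assume K: "K \<in> cells M"
      have c: "\<epsilon> \<le> conc S0 K" "conc S0 K < 1 / covol P" "0 < \<epsilon>"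
        using 2 K by fastforce+
      show "free_energy P (conc S1 K) - free_energy P (conc S0 K)
         \<le> stab_mu P (stab_theta P M \<delta>\<^sub>1 \<delta>\<^sub>2 S0) S0 S1 K * (conc S1 K - conc S0 K)"
      proof (rule free_energy_conc_le[OF P K])
        show "0 < conc S0 K" using c by linarith
        show "covol P * conc S0 K < 1"
          using c(2) P by (simp add: admissible_params_def pos_less_divide_eq mult.commute)
      qed (use 2 K in blast)+
    qed
    then show ?case using \<tau> by (simp add: divide_le_0_iff)
  qed
qed

end
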